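(* There exist a divergence-free field $V\in C^\infty(\mathbb T^3;\mathbb R^3)$, a divergence-free field $Y\in C^\infty(\mathbb T^3;\mathbb R^3)$, a gradient field $G\in C^\infty(\mathbb T^3;\mathbb R^3)$, a scalar function $\eta\in L^1(0,1)$, and, for every $\tau\in(0,1)$, a smooth function $b_\tau$ supported in $(\tau,1)$ such that $$\|b_\tau\|_2\le1,\qquad \left(\int_\tau^1\eta(t)b_\tau(t)\,dt\right)\left(\int_{\mathbb T^3}V\cdot[(Y\cdot\nabla)G]\,dx\right)=1 .$$ Consequently, $u(t,x)=\eta(t)V(x)$ has vanishing $L^1((\tau,1);\mathrm{BMO})$ tails (i.e. $\|u\|_{L^1((\tau,1);\mathrm{BMO})}\to0$ as $\tau\uparrow1$), the fields $$\mathfrak k_\tau(t,x)=b_\tau(t)\,(Y\cdot\nabla)G(x)$$ are bounded in $L^2((\tau,1);\mathcal H^1)$ uniformly in $\tau\in(0,1)$, and yet their Hardy--BMO pairings satisfy $$\int_\tau^1\langle u(t),\mathfrak k_\tau(t)\rangle_{\mathrm{BMO},\mathcal H^1}\,dt=1\qquad\text{for every }\tau\in(0,1).$$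
   Context: $\mathbb T^3=(\mathbb R/2\pi\mathbb Z)^3$. $\|b_\tau\|_2$ is the $L^2(\tau,1)$ norm in time. $\mathcal H^1$ is the mean-zero part of the periodic real Hardy space on $\mathbb T^3$ (mean-zero $h\in L^1$ with all periodic Riesz transforms $R_jh\in L^1$, $R_j=\partial_j(-\Delta)^{-1/2}$ on nonzero Fourier modes, norm $\|h\|_1+\sum_j\|R_jh\|_1$), componentwise for vector fields. $\mathrm{BMO}$ is periodic BMO modulo spatial constants, and $\langle\cdot,\cdot\rangle_{\mathrm{BMO},\mathcal H^1}$ is the Hardy--BMO duality pairing, which for bounded $b$ is $\int_{\mathbb T^3}b\cdot h\,dx$. *)

theory Defs
  imports "HOL-Analysis.Analysis"
begin

section \<open>Smooth fields on the torus\<close>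

definition dir_deriv :: "'a::real_normed_vector \<Rightarrow> ('a \<Rightarrow> 'b::real_normed_vector) \<Rightarrow> 'a \<Rightarrow> 'b" where
  "dir_deriv v f x = frechet_derivative f (at x) v"

(* All iterated partial derivatives exist and are Frechet differentiable (hence continuous),
   which is the usual notion of class C-infinity. *)
definition smooth :: "('a::euclidean_space \<Rightarrow> 'b::real_normed_vector) \<Rightarrow> bool" where
  "smooth f \<longleftrightarrow> (\<forall>vs. set vs \<subseteq> Basis \<longrightarrow> foldr dir_deriv vs f differentiable_on UNIV)"

(* Functions on (R / 2 pi Z)^3 are 2pi-periodic functions on R^3. *)
definition periodic :: "(real^3 \<Rightarrow> 'b) \<Rightarrow> bool" where
  "periodic f \<longleftrightarrow> (\<forall>x j. f (x + axis j (2 * pi)) = f x)"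

definition torus_smooth :: "(real^3 \<Rightarrow> 'b::real_normed_vector) \<Rightarrow> bool" where
  "torus_smooth f \<longleftrightarrow> periodic f \<and> smooth f"

abbreviation torus_cell :: "(real^3) set" where
  "torus_cell \<equiv> cbox 0 (vec (2 * pi))"

abbreviation torus_measure :: "(real^3) measure" where
  "torus_measure \<equiv> lebesgue_on torus_cell"

definition divergence :: "(real^3 \<Rightarrow> real^3) \<Rightarrow> real^3 \<Rightarrow> real" where
  "divergence V x = (\<Sum>j\<in>UNIV. dir_deriv (axis j 1) V x $ j)"

definition divergence_free :: "(real^3 \<Rightarrow> real^3) \<Rightarrow> bool" where
  "divergence_free V \<longleftrightarrow> (\<forall>x. divergence V x = 0)"

(* The potential is itself a function on the torus. *)
definition gradient_field :: "(real^3 \<Rightarrow> real^3) \<Rightarrow> bool" where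
  "gradient_field G \<longleftrightarrow> (\<exists>\<phi>. torus_smooth \<phi> \<and> (\<forall>x. GDERIV \<phi> x :> G x))"

definition advect :: "(real^3 \<Rightarrow> real^3) \<Rightarrow> (real^3 \<Rightarrow> real^3) \<Rightarrow> real^3 \<Rightarrow> real^3" where
  "advect Y G x = (\<Sum>j\<in>UNIV. Y x $ j *\<^sub>R dir_deriv (axis j 1) G x)"


section \<open>The periodic real Hardy space\<close>

definition torus_L1 :: "(real^3 \<Rightarrow> real) \<Rightarrow> bool" where
  "torus_L1 f \<longleftrightarrow> periodic f \<and> integrable torus_measure f"

definition freq :: "int^3 \<Rightarrow> real^3" where
  "freq k = (\<chi> j. of_int (k $ j))"

definition fourier_coeff :: "(real^3 \<Rightarrow> real) \<Rightarrow> int^3 \<Rightarrow> complex" where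
  "fourier_coeff f k =
     (LINT x|torus_measure. of_real (f x) * cis (- (freq k \<bullet> x))) / of_real ((2 * pi) ^ 3)"

(* The real function g in L^1 represents R_j h, where R_j has symbol i k_j / |k| for k \<noteq> 0
   and annihilates the zero mode. *)
definition riesz_transform :: "3 \<Rightarrow> (real^3 \<Rightarrow> real) \<Rightarrow> (real^3 \<Rightarrow> real) \<Rightarrow> bool" where
  "riesz_transform j h g \<longleftrightarrow> torus_L1 g \<and>
     (\<forall>k. fourier_coeff g k =
        (if k = 0 then 0
         else \<i> * of_real (freq k $ j / norm (freq k)) * fourier_coeff h k))"

definition torus_L1_norm :: "(real^3 \<Rightarrow> real) \<Rightarrow> ennreal" where
  "torus_L1_norm f = (\<integral>\<^sup>+x. ennreal \<bar>f x\<bar> \<partial>torus_measure)"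

(* The representative g of R_j h is unique up to null sets, so the infimum is the L^1 norm of
   R_j h; it is infinite (an infimum over the empty set) if R_j h is not in L^1.
   Hence the Hardy space consists of the h with finite norm. *)
definition hardy_norm :: "(real^3 \<Rightarrow> real) \<Rightarrow> ennreal" where
  "hardy_norm h =
     (if torus_L1 h \<and> (LINT x|torus_measure. h x) = 0
      then torus_L1_norm h + (\<Sum>j\<in>UNIV. INF g\<in>{g. riesz_transform j h g}. torus_L1_norm g)
      else \<infinity>)"

definition vec_hardy_norm :: "(real^3 \<Rightarrow> real^3) \<Rightarrow> ennreal" where
  "vec_hardy_norm h = (\<Sum>i\<in>UNIV. hardy_norm (\<lambda>x. h x $ i))"


section \<open>Periodic BMO\<close>

definition mean_osc :: "(real^3) set \<Rightarrow> (real^3 \<Rightarrow> real) \<Rightarrow> real" where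
  "mean_osc Q f =
     (LINT x|lebesgue_on Q. \<bar>f x - (LINT y|lebesgue_on Q. f y) / measure lebesgue Q\<bar>)
       / measure lebesgue Q"

(* A seminorm vanishing on constants: the quotient by constants is represented by functions.
   Cubes of side at most 2 pi are the cubes of the torus. *)
definition bmo_norm :: "(real^3 \<Rightarrow> real) \<Rightarrow> ennreal" where
  "bmo_norm f =
     (if torus_L1 f
      then SUP (a, r)\<in>UNIV \<times> {0<..2 * pi}. ennreal (mean_osc (cbox a (a + vec r)) f)
      else \<infinity>)"

definition vec_bmo_norm :: "(real^3 \<Rightarrow> real^3) \<Rightarrow> ennreal" where
  "vec_bmo_norm f = (\<Sum>i\<in>UNIV. bmo_norm (\<lambda>x. f x $ i))"

(* The pairing with b is the extension, continuous in the Hardy norm, of h \<mapsto> \<integral> b \<sqdot> h from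
   smooth mean-zero fields, which are dense in the Hardy space. *)
definition bmo_hardy_pairing :: "(real^3 \<Rightarrow> real^3) \<Rightarrow> (real^3 \<Rightarrow> real^3) \<Rightarrow> real" where
  "bmo_hardy_pairing b h =
     (THE c. \<forall>hs :: nat \<Rightarrow> real^3 \<Rightarrow> real^3.
        (\<forall>n. torus_smooth (hs n) \<and> vec_hardy_norm (hs n) < \<infinity>) \<longrightarrow>
        (\<lambda>n. vec_hardy_norm (\<lambda>x. hs n x - h x)) \<longlonglongrightarrow> 0 \<longrightarrow>
        (\<lambda>n. LINT x|torus_measure. b x \<bullet> hs n x) \<longlonglongrightarrow> c)"


section \<open>Bochner spaces in time\<close>

(* The target is the space of fields of finite norm N, N being one of the extended
   (semi)norms above; s n is a simple function with values in that space. *)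
definition strongly_measurable ::
    "((real^3 \<Rightarrow> real^3) \<Rightarrow> ennreal) \<Rightarrow> real set \<Rightarrow> (real \<Rightarrow> real^3 \<Rightarrow> real^3) \<Rightarrow> bool" where
  "strongly_measurable N S u \<longleftrightarrow>
     (\<exists>s :: nat \<Rightarrow> real \<Rightarrow> real^3 \<Rightarrow> real^3.
        (\<forall>n. simple_function (lebesgue_on S) (s n) \<and> (\<forall>t\<in>S. N (s n t) < \<infinity>)) \<and>
        (AE t in lebesgue_on S. (\<lambda>n. N (\<lambda>x. u t x - s n t x)) \<longlonglongrightarrow> 0))"

definition bochner_norm ::
    "nat \<Rightarrow> ((real^3 \<Rightarrow> real^3) \<Rightarrow> ennreal) \<Rightarrow> real set \<Rightarrow> (real \<Rightarrow> real^3 \<Rightarrow> real^3) \<Rightarrow> ennreal" where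
  "bochner_norm p N S u =
     (let I = (\<integral>\<^sup>+t. N (u t) ^ p \<partial>lebesgue_on S)
      in if I = \<infinity> then \<infinity> else ennreal (root p (enn2real I)))"

definition in_bochner ::
    "nat \<Rightarrow> ((real^3 \<Rightarrow> real^3) \<Rightarrow> ennreal) \<Rightarrow> real set \<Rightarrow> (real \<Rightarrow> real^3 \<Rightarrow> real^3) \<Rightarrow> bool" where
  "in_bochner p N S u \<longleftrightarrow> strongly_measurable N S u \<and> bochner_norm p N S u < \<infinity>"

end

theory Submission
  imports Defs "HOL-Computational_Algebra.Polynomial"
begin

text \<open>
  Take \<open>V = (sin x\<^sub>1 sin x\<^sub>2, cos x\<^sub>1 cos x\<^sub>2, 0)\<close>, \<open>Y = (sin x\<^sub>2, 0, 0)\<close> and \<open>G = \<nabla>(- sin x\<^sub>1)\<close>.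
  Then \<open>(Y \<sqdot> \<nabla>) G = (sin x\<^sub>1 sin x\<^sub>2, 0, 0)\<close> is a trigonometric polynomial with explicit Riesz transforms,
  and its integral against V is \<open>2 \<pi>\<^sup>3\<close>. The space part being fixed, everything happens in time: the weight
  \<open>(1 - t)\<^sup>-\<^sup>3\<^sup>/\<^sup>4\<close> is in \<open>L\<^sup>1\<close> but not in \<open>L\<^sup>2\<close> near 1, so on every tail there is a test
  function in the unit ball of \<open>L\<^sup>2\<close> whose pairing with the weight has the prescribed value.
\<close>

section \<open>Smooth functions\<close>

text \<open>The mechanism is a mismatch of exponents in time: tails that vanish in L^1 control
  pairings with families bounded in L^infinity, but not with families bounded only in L^2. Two
  features of the definitions shape the rest. A Riesz transform is given only through its Fourier
  coefficients, with the symbol \<open>\<i> * k_j / |k|\<close>; a profile whose frequencies all lie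
  on one sphere makes \<open>|k|\<close> a constant, so that the transform becomes a multiple of a
  partial derivative. And strong measurability and the Bochner norms refer to functional-valued
  \<open>N\<close>; since the space profile \<open>F\<close> is fixed, everything required of
  \<open>N\<close> is contained in the single estimate \<open>N (\<lambda>x. c *\<^sub>R F x) \<le>
  ennreal (K * \<bar>c\<bar>)\<close>, which turns both into questions about scalar functions of
  time. The second component of V does not meet the advected field; it is there to make V
  divergence-free.\<close>

lemma dir_deriv_eqI: "(f has_derivative f') (at x) \<Longrightarrow> dir_deriv v f x = f' v"
  unfolding dir_deriv_def by (metis frechet_derivative_at)

lemma differentiable_has_dir_deriv:
  assumes "f differentiable_on UNIV"
  shows "(f has_derivative (\<lambda>v. dir_deriv v f x)) (at x)"
  using assms unfolding dir_deriv_def differentiable_on_def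
  by (simp add: frechet_derivative_works[symmetric])

text \<open>Iterated partial derivatives never leave a family closed under \<open>dir_deriv\<close>,
  so a smoothness proof reduces to naming such a family of differentiable functions.\<close>

lemma smooth_coinduct:
  assumes "f \<in> S"
    and "\<And>g. g \<in> S \<Longrightarrow> g differentiable_on UNIV"
    and "\<And>g v. g \<in> S \<Longrightarrow> v \<in> Basis \<Longrightarrow> dir_deriv v g \<in> S"
  shows "smooth f"
proof -
  have "set vs \<subseteq> Basis \<Longrightarrow> foldr dir_deriv vs f \<in> S" for vs
    by (induction vs) (auto simp: assms)
  then show ?thesis
    unfolding smooth_def using assms(2) by blast
qed

lemma smooth_differentiable_on: "smooth f \<Longrightarrow> f differentiable_on UNIV"
  unfolding smooth_def by (metis empty_subsetI foldr_Nil id_apply list.set(1))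

lemma smooth_has_derivative:
  "smooth f \<Longrightarrow> (f has_derivative (\<lambda>v. dir_deriv v f x)) (at x)"
  by (simp add: differentiable_has_dir_deriv smooth_differentiable_on)

lemma smooth_dir_deriv:
  assumes "smooth f" "v \<in> Basis"
  shows "smooth (dir_deriv v f)"
  unfolding smooth_def
proof (intro allI impI)
  fix vs :: "'a list"
  assume "set vs \<subseteq> Basis"
  \<comment> \<open>\<open>foldr\<close> applies the last entry of the list first, so appending
    \<open>v\<close> makes it the innermost derivative.\<close>
  then have "foldr dir_deriv (vs @ [v]) f differentiable_on UNIV"
    using assms unfolding smooth_def by (intro assms(1)[unfolded smooth_def, rule_format]) auto
  then show "foldr dir_deriv vs (dir_deriv v f) differentiable_on UNIV"
    by simp
qed

lemma smooth_continuous_on: "smooth f \<Longrightarrow> continuous_on A f"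
  by (meson continuous_on_subset differentiable_imp_continuous_on smooth_differentiable_on top_greatest)

text \<open>Products of smooth functions are not visibly closed under differentiation, because the
  Leibniz rule yields a sum of products. Closing under both operations gives a family fit for
  \<open>smooth_coinduct\<close>.\<close>

inductive_set ring_hull :: "('a \<Rightarrow> real) set \<Rightarrow> ('a \<Rightarrow> real) set" for B where
  base: "f \<in> B \<Longrightarrow> f \<in> ring_hull B"
| add: "f \<in> ring_hull B \<Longrightarrow> g \<in> ring_hull B \<Longrightarrow> (\<lambda>x. f x + g x) \<in> ring_hull B"
| mult: "f \<in> ring_hull B \<Longrightarrow> g \<in> ring_hull B \<Longrightarrow> (\<lambda>x. f x * g x) \<in> ring_hull B"

lemma smooth_ring_hull:
  fixes f :: "'a::euclidean_space \<Rightarrow> real"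
  assumes "f \<in> ring_hull (Collect smooth)"
  shows "smooth f"
  using assms
proof (rule smooth_coinduct)
  fix g :: "'a \<Rightarrow> real"
  assume g: "g \<in> ring_hull (Collect smooth)"
  then have *: "g differentiable_on UNIV \<and> (\<forall>v\<in>Basis. dir_deriv v g \<in> ring_hull (Collect smooth))"
  proof induction
    case (base f)
    then show ?case
      by (auto simp: smooth_differentiable_on intro: smooth_dir_deriv ring_hull.base)
  next
    case (add f g)
    have "dir_deriv v (\<lambda>x. f x + g x) = (\<lambda>x. dir_deriv v f x + dir_deriv v g x)" for v
      using add by (intro ext dir_deriv_eqI has_derivative_add differentiable_has_dir_deriv) auto
    then show ?case
      using add by (auto intro: ring_hull.add differentiable_on_add)
  next
    case (mult f g)
    have "dir_deriv v (\<lambda>x. f x * g x) = (\<lambda>x. f x * dir_deriv v g x + dir_deriv v f x * g x)" for v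
      using mult by (intro ext dir_deriv_eqI has_derivative_mult differentiable_has_dir_deriv) auto
    then show ?case
      using mult by (simp add: ring_hull.add ring_hull.mult differentiable_on_mult)
  qed
  show "g differentiable_on UNIV" using * by blast
  show "dir_deriv v g \<in> ring_hull (Collect smooth)" if "v \<in> Basis" for v using * that by blast
qed

lemma smooth_mult:
  fixes f g :: "'a::euclidean_space \<Rightarrow> real"
  shows "smooth f \<Longrightarrow> smooth g \<Longrightarrow> smooth (\<lambda>x. f x * g x)"
  by (intro smooth_ring_hull ring_hull.intros) auto

lemma dir_deriv_const: "dir_deriv v (\<lambda>_. c) = (\<lambda>_. 0)"
  by (intro ext dir_deriv_eqI) (rule has_derivative_const)

lemma smooth_const: "smooth (\<lambda>_. c)"
  by (rule smooth_coinduct[where S = "range (\<lambda>c _. c)"]) (auto simp: dir_deriv_const)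

text \<open>The scalar \<open>c\<close> in the invariant family absorbs the factor \<open>p\<close>
  that each use of the chain rule produces.\<close>

lemma smooth_compose_affine:
  fixes f :: "real \<Rightarrow> real"
  assumes "smooth f"
  shows "smooth (\<lambda>t. f (p * t + q))"
proof (rule smooth_coinduct[where S = "{\<lambda>t. c * g (p * t + q) |c g. smooth g}"])
  show "(\<lambda>t. f (p * t + q)) \<in> {\<lambda>t. c * g (p * t + q) |c g. smooth g}"
    using assms by (force intro: exI[of _ 1])
  fix h :: "real \<Rightarrow> real"
  assume "h \<in> {\<lambda>t. c * g (p * t + q) |c g. smooth g}"
  then obtain c g where h: "h = (\<lambda>t. c * g (p * t + q))" and g: "smooth g"
    by blast
  have D: "(h has_derivative (\<lambda>v. c * dir_deriv (p * v) g (p * t + q))) (at t)" for t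
    unfolding h
    by (intro has_derivative_mult_right
        has_derivative_compose[where f = "\<lambda>t. p * t + q" and g = g, OF _ smooth_has_derivative[OF g]])
      (auto intro!: derivative_eq_intros)
  then show "h differentiable_on UNIV"
    unfolding differentiable_on_def differentiable_def by (auto simp: at_within_def)
  have "dir_deriv (p * 1) g x = p * dir_deriv 1 g x" for x
    using linear_cmul[OF has_derivative_linear[OF smooth_has_derivative[OF g]], of p 1] by simp
  then have "dir_deriv 1 h = (\<lambda>t. (c * p) * dir_deriv 1 g (p * t + q))"
    by (intro ext) (simp add: dir_deriv_eqI[OF D])
  moreover have "smooth (dir_deriv 1 g)"
    using g by (simp add: smooth_dir_deriv)
  ultimately show "dir_deriv v h \<in> {\<lambda>t. c * g (p * t + q) |c g. smooth g}" if "v \<in> Basis" for v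
    using that by auto
qed

section \<open>Smoothness of vector fields, component by component\<close>

lemma has_derivative_vec_lambda:
  fixes f :: "'n::finite \<Rightarrow> 'a::euclidean_space \<Rightarrow> real"
  assumes "\<And>i. (f i has_derivative f' i) (at x within S)"
  shows "((\<lambda>x. \<chi> i. f i x) has_derivative (\<lambda>v. \<chi> i. f' i v)) (at x within S)"
  using assms
  by (auto simp: has_derivative_componentwise_within[where f = "\<lambda>x. \<chi> i. f i x"] Basis_vec_def inner_axis)

lemma dir_deriv_vec_lambda:
  fixes f :: "'n::finite \<Rightarrow> 'a::euclidean_space \<Rightarrow> real"
  assumes "\<And>i. smooth (f i)"
  shows "dir_deriv v (\<lambda>x. \<chi> i. f i x) x = (\<chi> i. dir_deriv v (f i) x)"
  by (rule dir_deriv_eqI) (intro has_derivative_vec_lambda smooth_has_derivative assms)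

lemma smooth_vec_lambda:
  fixes f :: "'n::finite \<Rightarrow> 'a::euclidean_space \<Rightarrow> real"
  assumes "\<And>i. smooth (f i)"
  shows "smooth (\<lambda>x. \<chi> i. f i x)"
proof (rule smooth_coinduct[where S = "{\<lambda>x. \<chi> i. g i x |g. \<forall>i. smooth (g i)}"])
  show "(\<lambda>x. \<chi> i. f i x) \<in> {\<lambda>x. \<chi> i. g i x |g. \<forall>i. smooth (g i)}"
    using assms by blast
  fix h :: "'a \<Rightarrow> real^'n"
  assume "h \<in> {\<lambda>x. \<chi> i. g i x |g. \<forall>i. smooth (g i)}"
  then obtain g where h: "h = (\<lambda>x. \<chi> i. g i x)" and g: "\<And>i. smooth (g i)"
    by blast
  have D: "(h has_derivative (\<lambda>v. \<chi> i. dir_deriv v (g i) x)) (at x)" for x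
    unfolding h by (intro has_derivative_vec_lambda smooth_has_derivative g)
  then show "h differentiable_on UNIV"
    unfolding differentiable_on_def differentiable_def by (auto simp: at_within_def)
  have "dir_deriv v h = (\<lambda>x. \<chi> i. dir_deriv v (g i) x)" for v
    by (intro ext) (simp add: dir_deriv_eqI[OF D])
  then show "dir_deriv v h \<in> {\<lambda>x. \<chi> i. g i x |g. \<forall>i. smooth (g i)}" if "v \<in> Basis" for v
    using that g by (intro CollectI exI[of _ "\<lambda>i. dir_deriv v (g i)"]) (simp add: smooth_dir_deriv)
qed

text \<open>The linear span of the two functions is closed under every directional derivative, so
  both are obtained from one coinduction.\<close>

lemma smooth_sin_nth: "smooth (\<lambda>x :: real^'n. sin (x $ j))"
  and smooth_cos_nth: "smooth (\<lambda>x :: real^'n. cos (x $ j))"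
proof -
  let ?S = "{\<lambda>x :: real^'n. a * sin (x $ j) + b * cos (x $ j) |a b. True}"
  have *: "smooth (\<lambda>x :: real^'n. a * sin (x $ j) + b * cos (x $ j))" for a b
  proof (rule smooth_coinduct[where S = ?S])
    fix g :: "real^'n \<Rightarrow> real"
    assume "g \<in> ?S"
    then obtain a b where g: "g = (\<lambda>x. a * sin (x $ j) + b * cos (x $ j))"
      by blast
    have D: "(g has_derivative (\<lambda>v. a * (v $ j * cos (x $ j)) + b * (- (v $ j * sin (x $ j))))) (at x)" for x
      unfolding g by (auto intro!: derivative_eq_intros bounded_linear_imp_has_derivative
          bounded_linear_vec_nth simp: algebra_simps)
    then show "g differentiable_on UNIV"
      unfolding differentiable_on_def differentiable_def by (auto simp: at_within_def)
    have "dir_deriv v g = (\<lambda>x. (- b * v $ j) * sin (x $ j) + (a * v $ j) * cos (x $ j))" for v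
      by (intro ext) (simp add: dir_deriv_eqI[OF D])
    then show "dir_deriv v g \<in> ?S" for v
      by blast
  qed auto
  show "smooth (\<lambda>x :: real^'n. sin (x $ j))"
    using *[of 1 0] by simp
  show "smooth (\<lambda>x :: real^'n. cos (x $ j))"
    using *[of 0 1] by simp
qed

text \<open>All derivatives of exp(-1/x) lie in the family p(1/x) exp(-1/x) with p a polynomial.\<close>

definition flat_exp :: "real poly \<Rightarrow> real \<Rightarrow> real" where
  "flat_exp p x = (if x \<le> 0 then 0 else poly p (1 / x) * exp (- (1 / x)))"

lemma poly_mult_exp_minus_tendsto_0: "((\<lambda>x. poly p x * exp (- x)) \<longlongrightarrow> (0::real)) at_top"
proof -
  have "((\<lambda>x. \<Sum>i\<le>degree p. coeff p i * (x ^ i / exp x)) \<longlongrightarrow> (\<Sum>i\<le>degree p. coeff p i * 0)) at_top"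
    by (intro tendsto_intros tendsto_power_div_exp_0)
  then show ?thesis
    by (simp add: poly_altdef sum_distrib_right exp_minus divide_inverse mult.assoc)
qed

text \<open>Both the polynomial and the exponential contribute a factor \<open>1 / x\<^sup>2\<close>
  by the chain rule, and \<open>[:0, 0, 1:]\<close> is the polynomial X^2 that records it. Only the
  point 0 needs a limit argument.\<close>

lemma flat_exp_DERIV:
  "(flat_exp p has_real_derivative flat_exp ([:0, 0, 1:] * (p - pderiv p)) x) (at x)"
proof (cases x "0 :: real" rule: linorder_cases)
  case less
  then have "\<forall>\<^sub>F y in nhds x. flat_exp p y = 0"
    by (auto simp: flat_exp_def eventually_nhds intro!: exI[of _ "{..<0}"])
  with less show ?thesis
    by (subst DERIV_cong_ev[OF refl _ refl, where g = "\<lambda>_. 0"]) (auto simp: flat_exp_def)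
next
  case greater
  then have ev: "\<forall>\<^sub>F y in nhds x. flat_exp p y = poly p (1 / y) * exp (- (1 / y))"
    by (auto simp: flat_exp_def eventually_nhds intro!: exI[of _ "{0<..}"])
  have "((\<lambda>y. poly p (1 / y) * exp (- (1 / y))) has_real_derivative
      flat_exp ([:0, 0, 1:] * (p - pderiv p)) x) (at x)"
    using greater
    by (auto intro!: derivative_eq_intros DERIV_chain2[OF poly_DERIV]
        simp: flat_exp_def field_simps power2_eq_square)
  then show ?thesis
    by (subst DERIV_cong_ev[OF refl ev refl])
next
  case equal
  \<comment> \<open>This is the difference quotient at 0. On the right, dividing by \<open>y\<close>
    multiplies \<open>p\<close> by X, so exponential decay in \<open>1 / y\<close> still
    wins.\<close>
  have "((\<lambda>y. flat_exp p y / y) \<longlongrightarrow> 0) (at_right 0)"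
  proof (rule Lim_transform_eventually)
    show "((\<lambda>y. poly ([:0, 1:] * p) (1 / y) * exp (- (1 / y))) \<longlongrightarrow> 0) (at_right (0::real))"
      using filterlim_compose[OF poly_mult_exp_minus_tendsto_0 filterlim_inverse_at_top_right, of "[:0, 1:] * p"]
      by (simp add: inverse_eq_divide)
    show "\<forall>\<^sub>F y in at_right 0. poly ([:0, 1:] * p) (1 / y) * exp (- (1 / y)) = flat_exp p y / y"
      by (auto simp: flat_exp_def eventually_at_filter)
  qed
  moreover have "((\<lambda>y. flat_exp p y / y) \<longlongrightarrow> 0) (at_left 0)"
    by (rule tendsto_eventually) (auto simp: flat_exp_def eventually_at_filter)
  ultimately have "((\<lambda>y. flat_exp p y / y) \<longlongrightarrow> 0) (at 0)"
    by (simp add: filterlim_at_split)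
  with equal show ?thesis
    by (simp add: has_field_derivative_iff flat_exp_def)
qed

lemma smooth_flat_exp: "smooth (flat_exp p)"
proof (rule smooth_coinduct[where S = "range flat_exp"])
  fix g
  assume "g \<in> range flat_exp"
  then obtain p where g: "g = flat_exp p"
    by blast
  have D: "(g has_derivative (\<lambda>v. flat_exp ([:0, 0, 1:] * (p - pderiv p)) x * v)) (at x)" for x
    using flat_exp_DERIV[of p x] unfolding g has_field_derivative_def .
  then show "g differentiable_on UNIV"
    unfolding differentiable_on_def differentiable_def by (auto simp: at_within_def)
  show "dir_deriv v g \<in> range flat_exp" if "v \<in> Basis" for v
  proof -
    have "dir_deriv v g = flat_exp ([:0, 0, 1:] * (p - pderiv p))"
      using that by (intro ext) (simp add: dir_deriv_eqI[OF D])
    then show ?thesis by blast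
  qed
qed auto

text \<open>On (0,1) this is the classical exp(-1/s - 1/(1-s)); elsewhere one of the factors
  vanishes.\<close>

definition bump :: "real \<Rightarrow> real" where
  "bump s = flat_exp 1 s * flat_exp 1 (1 - s)"

lemma smooth_bump: "smooth bump"
  unfolding bump_def[abs_def]
  using smooth_compose_affine[OF smooth_flat_exp, of 1 "-1" 1]
  by (intro smooth_mult smooth_flat_exp) (simp add: algebra_simps)

lemma bump_pos: "0 < s \<Longrightarrow> s < 1 \<Longrightarrow> 0 < bump s"
  by (simp add: bump_def flat_exp_def)

lemma bump_nonneg: "0 \<le> bump s"
  by (simp add: bump_def flat_exp_def)

lemma bump_le_1: "bump s \<le> 1"
  by (simp add: bump_def flat_exp_def mult_le_one)

lemma bump_eq_0: "s \<notin> {0<..<1} \<Longrightarrow> bump s = 0"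
  by (auto simp: bump_def flat_exp_def)


section \<open>Fourier coefficients of products\<close>

text \<open>\<open>lborel\<close> is the image of the product of one-dimensional measures indexed by
  \<open>Basis\<close>, so Fubini applies. A general normed field as codomain covers both complex
  exponentials and real integrands.\<close>

lemma integral_lborel_prod:
  fixes f :: "'a::euclidean_space \<Rightarrow> real \<Rightarrow> 'b::{real_normed_field, banach, second_countable_topology}"
  assumes f: "\<And>b. b \<in> Basis \<Longrightarrow> integrable lborel (f b)"
  shows "(\<integral>x. (\<Prod>b\<in>Basis. f b (x \<bullet> b)) \<partial>lborel) = (\<Prod>b\<in>Basis. integral\<^sup>L lborel (f b))"
proof -
  interpret product_sigma_finite "\<lambda>_. lborel :: real measure"
    by standard
  have [measurable]: "b \<in> Basis \<Longrightarrow> f b \<in> borel_measurable borel" for b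
    using borel_measurable_integrable[OF f] by simp
  have "(\<integral>x. (\<Prod>b\<in>Basis. f b (x \<bullet> b)) \<partial>lborel)
      = (\<integral>y. (\<Prod>b\<in>Basis. f b (y b)) \<partial>(\<Pi>\<^sub>M b\<in>Basis. lborel))"
    by (subst lborel_eq, subst integral_distr) auto
  also have "\<dots> = (\<Prod>b\<in>Basis. integral\<^sup>L lborel (f b))"
    by (rule product_integral_prod) (use f in auto)
  finally show ?thesis .
qed

lemma integral_cbox_prod:
  fixes f :: "'n::finite \<Rightarrow> real \<Rightarrow> 'b::{real_normed_field, banach, second_countable_topology}"
    and a b :: "real^'n"
  assumes f: "\<And>j. continuous_on UNIV (f j)"
  shows "(LINT x|lebesgue_on (cbox a b). (\<Prod>j\<in>UNIV. f j (x $ j)))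
    = (\<Prod>j\<in>UNIV. LINT t|lebesgue_on {a $ j..b $ j}. f j t)"
proof -
  \<comment> \<open>The indicator of a box is the product of the indicators of its sides, so the
    restriction is absorbed factor by factor.\<close>
  define g where "g j t = indicator {a $ j..b $ j} t *\<^sub>R f j t" for j t
  have [measurable]: "f j \<in> borel_measurable borel" for j
    using f by (rule borel_measurable_continuous_onI)
  have gm [measurable]: "g j \<in> borel_measurable borel" for j
    unfolding g_def by measurable
  have gi: "integrable lborel (g j)" for j
    unfolding g_def by (rule borel_integrable_compact) (auto intro: continuous_on_subset[OF f])
  have Basis: "Basis = range (\<lambda>j. axis j 1 :: real^'n)"
    by (auto simp: Basis_vec_def)
  have inj: "inj (\<lambda>j. axis j 1 :: real^'n)"
    by (simp add: inj_on_def axis_eq_axis)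
  \<comment> \<open>\<open>i\<close> translates basis vectors back into coordinate indices.\<close>
  define i where "i = (inv (\<lambda>j. axis j 1) :: real^'n \<Rightarrow> 'n)"
  have i: "i (axis j 1) = j" for j
    unfolding i_def by (rule inv_f_f[OF inj])
  have "indicator (cbox a b) x *\<^sub>R (\<Prod>j\<in>UNIV. f j (x $ j)) = (\<Prod>j\<in>UNIV. g j (x $ j))" for x
  proof (cases "x \<in> cbox a b")
    case False
    then obtain j where "x $ j \<notin> {a $ j..b $ j}"
      by (auto simp: mem_box_cart)
    then have "g j (x $ j) = 0"
      by (simp add: g_def)
    then show ?thesis
      using False by (auto intro: prod_zero)
  qed (simp add: g_def mem_box_cart)
  then have "(LINT x|lebesgue_on (cbox a b). (\<Prod>j\<in>UNIV. f j (x $ j)))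
      = (LINT x|lebesgue. (\<Prod>j\<in>UNIV. g j (x $ j)))"
    by (subst integral_restrict_space) auto
  also have "\<dots> = (LINT x|lborel. (\<Prod>j\<in>UNIV. g j (x $ j)))"
    by (rule integral_completion) measurable
  also have "\<dots> = (LINT x|lborel. (\<Prod>b\<in>Basis. g (i b) (x \<bullet> b)))"
    unfolding Basis by (simp add: prod.reindex[OF inj] i inner_axis)
  also have "\<dots> = (\<Prod>b\<in>Basis. integral\<^sup>L lborel (g (i b)))"
    by (rule integral_lborel_prod) (rule gi)
  also have "\<dots> = (\<Prod>j\<in>UNIV. integral\<^sup>L lborel (g j))"
    unfolding Basis by (simp add: prod.reindex[OF inj] i)
  also have "\<dots> = (\<Prod>j\<in>UNIV. LINT t|lebesgue_on {a $ j..b $ j}. f j t)"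
  proof (rule prod.cong[OF refl])
    fix j
    have "integral\<^sup>L lborel (g j) = integral\<^sup>L lebesgue (g j)"
      by (rule integral_completion[symmetric]) measurable
    then show "integral\<^sup>L lborel (g j) = (LINT t|lebesgue_on {a $ j..b $ j}. f j t)"
      by (subst integral_restrict_space) (auto simp: g_def[abs_def])
  qed
  finally show ?thesis .
qed

section \<open>Fourier coefficients on the circle by integration by parts\<close>

lemma lebesgue_on_FTC:
  fixes F :: "real \<Rightarrow> 'a::euclidean_space"
  assumes "a \<le> b"
    and F: "\<And>x. (F has_vector_derivative f x) (at x)"
    and f: "continuous_on UNIV f"
  shows "(LINT t|lebesgue_on {a..b}. f t) = F b - F a"
proof -
  have "integrable (lebesgue_on {a..b}) f"
    using continuous_imp_integrable_real continuous_on_subset[OF f] by blast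
  then have "(LINT t|lebesgue_on {a..b}. f t) = integral {a..b} f"
    by (simp add: lebesgue_integral_eq_integral)
  also have "\<dots> = F b - F a"
    by (intro integral_unique fundamental_theorem_of_calculus assms
        has_vector_derivative_at_within)
  finally show ?thesis .
qed

text \<open>Left unnormalised: \<open>fourier_coeff\<close> divides once by the volume
  \<open>(2 * pi) ^ 3\<close>.\<close>

definition circle_coeff :: "(real \<Rightarrow> real) \<Rightarrow> int \<Rightarrow> complex" where
  "circle_coeff f n = (LINT t|lebesgue_on {0..2 * pi}. of_real (f t) * cis (- (of_int n * t)))"

text \<open>The difference of the two integrands is the derivative of
  \<open>of_real (f t) * cis (- (of_int n * t))\<close>, whose values at the endpoints agree by
  periodicity.\<close>

lemma circle_coeff_deriv:
  assumes f: "\<And>t. (f has_real_derivative f' t) (at t)"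
    and f': "continuous_on UNIV f'"
    and periodic: "f (2 * pi) = f 0"
  shows "circle_coeff f' n = \<i> * of_int n * circle_coeff f n"
proof -
  have cf: "continuous_on UNIV f"
    using f by (meson DERIV_continuous_on has_field_derivative_at_within)
  have ints: "integrable (lebesgue_on {0..2 * pi}) (\<lambda>t. of_real (g t) * cis (- (of_int n * t)))"
    if "continuous_on UNIV g" for g
    by (rule continuous_imp_integrable_real)
      (intro continuous_intros continuous_on_subset[OF that], auto)
  have "(LINT t|lebesgue_on {0..2 * pi}. of_real (f' t) * cis (- (of_int n * t))
        - \<i> * of_int n * (of_real (f t) * cis (- (of_int n * t))))
      = of_real (f (2 * pi)) * cis (- (of_int n * (2 * pi))) - of_real (f 0) * cis (- (of_int n * 0))"
  proof (rule lebesgue_on_FTC)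
    fix t
    have "((\<lambda>t. cis (- (of_int n * t))) has_vector_derivative (- (of_int n)) *\<^sub>R (\<i> * cis (- (of_int n * t)))) (at t)"
      unfolding cis_conv_exp of_real_minus of_real_mult
      by (rule has_vector_derivative_real_field)
        (auto intro!: derivative_eq_intros simp: scaleR_conv_of_real)
    then show "((\<lambda>t. of_real (f t) * cis (- (of_int n * t))) has_vector_derivative
        of_real (f' t) * cis (- (of_int n * t))
        - \<i> * of_int n * (of_real (f t) * cis (- (of_int n * t)))) (at t)"
      using f by (auto intro!: derivative_eq_intros has_vector_derivative_of_real
          simp: has_real_derivative_iff_has_vector_derivative scaleR_conv_of_real algebra_simps)
  qed (auto intro!: continuous_intros cf f')
  also have "\<dots> = 0"
    using cis_multiple_2pi[of "- of_int n"] periodic by (simp add: mult.commute)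
  finally have "circle_coeff f' n - \<i> * of_int n * circle_coeff f n = 0"
    unfolding circle_coeff_def using ints[OF cf] ints[OF f'] by simp
  then show ?thesis
    by simp
qed

lemma circle_coeff_cos: "circle_coeff cos n = \<i> * of_int n * circle_coeff sin n"
  by (rule circle_coeff_deriv) (auto intro!: derivative_eq_intros continuous_intros)

text \<open>Taking coefficients in sin'' = - sin multiplies the coefficient of sine by
  \<open>n\<^sup>2 - 1\<close> and gives 0. This locates the frequencies without evaluating any
  trigonometric integral.\<close>

lemma circle_coeff_sin_eq_0: "n\<^sup>2 \<noteq> 1 \<Longrightarrow> circle_coeff sin n = 0"
proof -
  have "circle_coeff (\<lambda>t. - sin t) n = \<i> * of_int n * circle_coeff cos n"
    by (rule circle_coeff_deriv) (auto intro!: derivative_eq_intros continuous_intros)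
  moreover have "circle_coeff (\<lambda>t. - sin t) n = - circle_coeff sin n"
    by (simp add: circle_coeff_def)
  ultimately have "of_int (n\<^sup>2 - 1) * circle_coeff sin n = 0"
    by (simp add: circle_coeff_cos power2_eq_square algebra_simps)
  moreover assume "n\<^sup>2 \<noteq> 1"
  ultimately show ?thesis
    by (metis eq_iff_diff_eq_0 mult_eq_0_iff of_int_eq_0_iff)
qed

lemma circle_coeff_one_eq_0: "n \<noteq> 0 \<Longrightarrow> circle_coeff (\<lambda>_. 1) n = 0"
  using circle_coeff_deriv[of "\<lambda>_. 1" "\<lambda>_. 0" n] by (simp add: circle_coeff_def)

lemma fourier_coeff_prod:
  assumes f: "\<And>j. continuous_on UNIV (f j)"
  shows "fourier_coeff (\<lambda>x. \<Prod>j\<in>UNIV. f j (x $ j)) k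
    = (\<Prod>j\<in>UNIV. circle_coeff (f j) (k $ j)) / of_real ((2 * pi) ^ 3)"
proof -
  have cis_sum: "cis (\<Sum>j\<in>A. g j) = (\<Prod>j\<in>A. cis (g j))" if "finite A" for A :: "3 set" and g
    using that by induction (auto simp: cis_mult[symmetric])
  have "cis (- (freq k \<bullet> x)) = (\<Prod>j\<in>UNIV. cis (- (of_int (k $ j) * x $ j)))" for x
    by (simp add: inner_vec_def freq_def sum_negf[symmetric] cis_sum)
  then have "(LINT x|torus_measure. of_real (\<Prod>j\<in>UNIV. f j (x $ j)) * cis (- (freq k \<bullet> x)))
      = (LINT x|torus_measure. (\<Prod>j\<in>UNIV. of_real (f j (x $ j)) * cis (- (of_int (k $ j) * x $ j))))"
    by (simp add: prod.distrib)
  also have "\<dots> = (\<Prod>j\<in>UNIV. LINT t|lebesgue_on {(0::real^3) $ j..vec (2 * pi) $ j}.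
      of_real (f j t) * cis (- (of_int (k $ j) * t)))"
    by (rule integral_cbox_prod) (intro continuous_intros f)
  finally show ?thesis
    by (simp add: fourier_coeff_def circle_coeff_def)
qed

lemma torus_L1_continuous:
  assumes "periodic f" "continuous_on UNIV f"
  shows "torus_L1 f"
  unfolding torus_L1_def
  using assms continuous_imp_integrable continuous_on_subset by blast


section \<open>Hardy and BMO bounds for trigonometric fields\<close>

lemma prod_UNIV_3: "(\<Prod>j\<in>UNIV. f j) = f 1 * f 2 * f (3 :: 3)" for f :: "3 \<Rightarrow> 'a::comm_monoid_mult"
  unfolding UNIV_3 by (simp add: ac_simps)

lemma torus_L1_norm_le_hardy_norm: "torus_L1_norm h \<le> hardy_norm h"
  by (simp add: hardy_norm_def)

lemma torus_L1_norm_bounded: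
  assumes "\<And>x. \<bar>f x\<bar> \<le> B"
  shows "torus_L1_norm f \<le> ennreal (B * measure lebesgue torus_cell)"
proof -
  have B: "0 \<le> B"
    using assms[of 0] by simp
  have "torus_L1_norm f \<le> (\<integral>\<^sup>+x. ennreal B \<partial>torus_measure)"
    unfolding torus_L1_norm_def by (intro nn_integral_mono ennreal_leI assms)
  also have "\<dots> = ennreal B * emeasure lebesgue torus_cell"
    by (simp add: emeasure_restrict_space)
  also have "\<dots> = ennreal (B * measure lebesgue torus_cell)"
    by (subst emeasure_eq_measure2) (auto simp: ennreal_mult B)
  finally show ?thesis .
qed

definition sin_sin :: "real^3 \<Rightarrow> real" where
  "sin_sin x = sin (x $ 1) * sin (x $ 2)"

text \<open>All frequencies of \<^const>\<open>sin_sin\<close> have length \<open>sqrt 2\<close>, so its Riesz transforms are its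
  partial derivatives divided by \<open>sqrt 2\<close>.\<close>

definition sin_sin_riesz :: "3 \<Rightarrow> real^3 \<Rightarrow> real" where
  "sin_sin_riesz j x =
     (if j = 1 then cos (x $ 1) * sin (x $ 2)
      else if j = 2 then sin (x $ 1) * cos (x $ 2) else 0) / sqrt 2"

lemma torus_L1_sin_sin: "torus_L1 (\<lambda>x. c * sin_sin x)"
  by (rule torus_L1_continuous)
    (auto simp: periodic_def sin_sin_def axis_def intro!: continuous_intros)

lemma torus_L1_sin_sin_riesz: "torus_L1 (\<lambda>x. c * sin_sin_riesz j x)"
  by (rule torus_L1_continuous; cases "j = 1"; cases "j = 2")
    (auto simp: periodic_def sin_sin_riesz_def axis_def intro!: continuous_intros)

lemma fourier_coeff_cmult: "fourier_coeff (\<lambda>x. c * f x) k = of_real c * fourier_coeff f k"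
  by (simp add: fourier_coeff_def mult.assoc)

lemma fourier_coeff_sin_sin:
  "fourier_coeff sin_sin k = circle_coeff sin (k $ 1) * circle_coeff sin (k $ 2)
     * circle_coeff (\<lambda>_. 1) (k $ 3) / of_real ((2 * pi) ^ 3)"
proof -
  define f where "f j = (if j = (3 :: 3) then (\<lambda>_. 1) else sin :: real \<Rightarrow> real)" for j
  have "sin_sin = (\<lambda>x. \<Prod>j\<in>UNIV. f j (x $ j))"
    by (simp add: fun_eq_iff sin_sin_def prod_UNIV_3 f_def)
  then show ?thesis
    using fourier_coeff_prod[of f k] by (simp add: prod_UNIV_3 f_def continuous_on_sin continuous_on_id)
qed

text \<open>For j = 1, 2 the transform replaces the sine in coordinate j by a cosine, and
  \<open>circle_coeff_cos\<close> converts this into the factor \<open>\<i> * k_j\<close>. The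
  divisor is still the constant \<open>sqrt 2\<close>, at every frequency.\<close>

lemma fourier_coeff_sin_sin_riesz:
  "fourier_coeff (sin_sin_riesz j) k = \<i> * of_real (freq k $ j / sqrt 2) * fourier_coeff sin_sin k"
proof -
  define f where "f i = (if i = (3 :: 3) then (\<lambda>_. 1) else if i = j then cos else sin :: real \<Rightarrow> real)" for i
  have cont: "continuous_on UNIV (f i)" for i
    by (simp add: f_def continuous_on_sin continuous_on_cos continuous_on_id)
  consider "j = 3" | "j = 1 \<or> j = 2"
    using exhaust_3[of j] by blast
  then show ?thesis
  proof cases
    case 1
    \<comment> \<open>Either the third frequency is 0 or the coefficient of the constant factor
      vanishes there.\<close>
    then have "of_real (freq k $ j) * circle_coeff (\<lambda>_. 1) (k $ 3) = 0"
      using circle_coeff_one_eq_0[of "k $ 3"] by (auto simp: freq_def)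
    moreover have "sin_sin_riesz j = (\<lambda>_. 0)"
      using 1 by (simp add: fun_eq_iff sin_sin_riesz_def)
    moreover have "fourier_coeff (\<lambda>_. 0) k = 0"
      by (simp add: fourier_coeff_def)
    ultimately show ?thesis
      by (auto simp: fourier_coeff_sin_sin)
  next
    case 2
    then have "sin_sin_riesz j = (\<lambda>x. (1 / sqrt 2) * (\<Prod>i\<in>UNIV. f i (x $ i)))"
      by (auto simp: fun_eq_iff sin_sin_riesz_def prod_UNIV_3 f_def)
    then have "fourier_coeff (sin_sin_riesz j) k
        = of_real (1 / sqrt 2) * fourier_coeff (\<lambda>x. \<Prod>i\<in>UNIV. f i (x $ i)) k"
      by (simp only: fourier_coeff_cmult)
    also have "\<dots> = of_real (1 / sqrt 2) * ((\<Prod>i\<in>UNIV. circle_coeff (f i) (k $ i)) / of_real ((2 * pi) ^ 3))"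
      by (simp only: fourier_coeff_prod[OF cont])
    finally show ?thesis
      using 2 by (auto simp: fourier_coeff_sin_sin prod_UNIV_3 f_def circle_coeff_cos freq_def)
  qed
qed

text \<open>A nonzero coefficient forces k_1 and k_2 to be 1 or -1 and k_3 to be 0. This is what
  allows \<open>sqrt 2\<close> to be exchanged for \<open>norm (freq k)\<close> in the Riesz
  symbol.\<close>

lemma fourier_coeff_sin_sin_eq_0:
  assumes "norm (freq k) \<noteq> sqrt 2"
  shows "fourier_coeff sin_sin k = 0"
proof (rule ccontr)
  assume *: "fourier_coeff sin_sin k \<noteq> 0"
  have "(k $ 1)\<^sup>2 = 1" "(k $ 2)\<^sup>2 = 1" "k $ 3 = 0"
    using * circle_coeff_sin_eq_0[of "k $ 1"] circle_coeff_sin_eq_0[of "k $ 2"]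
      circle_coeff_one_eq_0[of "k $ 3"] by (auto simp: fourier_coeff_sin_sin)
  then have "(real_of_int (k $ 1))\<^sup>2 = 1" "(real_of_int (k $ 2))\<^sup>2 = 1" "k $ 3 = 0"
    by (metis of_int_1 of_int_power)+
  then have "norm (freq k) = sqrt 2"
    by (simp add: norm_vec_def L2_set_def freq_def sum_3)
  with assms show False ..
qed

lemma riesz_transform_sin_sin:
  "riesz_transform j (\<lambda>x. c * sin_sin x) (\<lambda>x. c * sin_sin_riesz j x)"
  unfolding riesz_transform_def
proof (intro conjI allI torus_L1_sin_sin_riesz)
  fix k
  show "fourier_coeff (\<lambda>x. c * sin_sin_riesz j x) k = (if k = 0 then 0
      else \<i> * of_real (freq k $ j / norm (freq k)) * fourier_coeff (\<lambda>x. c * sin_sin x) k)"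
    unfolding fourier_coeff_cmult fourier_coeff_sin_sin_riesz
    using fourier_coeff_sin_sin_eq_0[of k]
    \<comment> \<open>On the sphere of radius \<open>sqrt 2\<close> the two symbols coincide; off
      it, and in particular at the zero mode, both sides vanish.\<close>
    by (cases "norm (freq k) = sqrt 2") (auto simp: freq_def)
qed

section \<open>Integrals over the periodic cell\<close>

lemma integral_sin: "(LINT t|lebesgue_on {0..2 * pi}. sin t) = 0"
  by (subst lebesgue_on_FTC[where F = "\<lambda>t. - cos t"])
    (auto simp: has_real_derivative_iff_has_vector_derivative[symmetric]
      intro!: derivative_eq_intros continuous_intros)

lemma integral_sin_squared: "(LINT t|lebesgue_on {0..2 * pi}. sin t * sin t) = pi"
proof (subst lebesgue_on_FTC[where F = "\<lambda>t. (t - sin t * cos t) / 2"])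
  show "((\<lambda>t. (t - sin t * cos t) / 2) has_vector_derivative sin t * sin t) (at t)" for t :: real
  proof -
    have "((\<lambda>t. (t - sin t * cos t) / 2) has_real_derivative (1 - (cos t * cos t - sin t * sin t)) / 2) (at t)"
      by (auto intro!: derivative_eq_intros)
    moreover have "(1 - (cos t * cos t - sin t * sin t)) / 2 = sin t * sin t"
      using sin_cos_squared_add3[of t] by argo
    ultimately show ?thesis
      by (simp add: has_real_derivative_iff_has_vector_derivative)
  qed
qed (auto intro!: continuous_intros)

lemma integral_torus_prod_12:
  fixes f :: "real \<Rightarrow> real"
  assumes "continuous_on UNIV f"
  shows "(LINT x|torus_measure. f (x $ 1) * f (x $ 2)) = (LINT t|lebesgue_on {0..2 * pi}. f t)\<^sup>2 * (2 * pi)"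
proof -
  define g where "g j = (if j = (3 :: 3) then (\<lambda>_. 1) else f)" for j
  have "continuous_on UNIV (g j)" for j
    by (simp add: g_def assms)
  then have "(LINT x|torus_measure. (\<Prod>j\<in>UNIV. g j (x $ j)))
      = (\<Prod>j\<in>UNIV. LINT t|lebesgue_on {(0::real^3) $ j..vec (2 * pi) $ j}. g j t)"
    by (rule integral_cbox_prod)
  then show ?thesis
    by (simp add: prod_UNIV_3 g_def power2_eq_square measure_restrict_space)
qed

lemma integral_sin_sin: "(LINT x|torus_measure. sin_sin x) = 0"
  unfolding sin_sin_def by (subst integral_torus_prod_12) (auto simp: integral_sin intro!: continuous_intros)

lemma integral_sin_sin_squared: "(LINT x|torus_measure. sin_sin x * sin_sin x) = 2 * pi ^ 3"
proof -
  have "(LINT x|torus_measure. sin_sin x * sin_sin x)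
      = (LINT x|torus_measure. (sin (x $ 1) * sin (x $ 1)) * (sin (x $ 2) * sin (x $ 2)))"
    by (simp add: sin_sin_def ac_simps)
  also have "\<dots> = pi\<^sup>2 * (2 * pi)"
    by (subst integral_torus_prod_12) (auto simp: integral_sin_squared intro!: continuous_intros)
  finally show ?thesis
    by (simp add: power2_eq_square power3_eq_cube)
qed

text \<open>The 4 counts the function itself and its three Riesz transforms, each bounded pointwise
  by \<open>\<bar>c\<bar>\<close>. The infimum is estimated by the explicit representative
  \<open>sin_sin_riesz\<close>.\<close>

lemma hardy_norm_sin_sin:
  "hardy_norm (\<lambda>x. c * sin_sin x) \<le> ennreal (4 * measure lebesgue torus_cell * \<bar>c\<bar>)"
proof -
  let ?T = "ennreal (\<bar>c\<bar> * measure lebesgue torus_cell)"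
  have "\<bar>c * sin_sin x\<bar> \<le> \<bar>c\<bar>" for x
    unfolding abs_mult by (rule mult_left_le) (auto simp: sin_sin_def abs_mult intro!: mult_le_one)
  then have 1: "torus_L1_norm (\<lambda>x. c * sin_sin x) \<le> ?T"
    by (rule torus_L1_norm_bounded)
  have "(INF g\<in>{g. riesz_transform j (\<lambda>x. c * sin_sin x) g}. torus_L1_norm g) \<le> ?T" for j
  proof (rule INF_lower2[of "\<lambda>x. c * sin_sin_riesz j x"])
    have "\<bar>sin_sin_riesz j x\<bar> \<le> 1" for x
    proof -
      have "\<bar>cos (x $ 1) * sin (x $ 2)\<bar> \<le> 1" "\<bar>sin (x $ 1) * cos (x $ 2)\<bar> \<le> 1"
        unfolding abs_mult by (auto intro!: mult_le_one)
      moreover have "(1 :: real) \<le> sqrt 2"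
        by simp
      ultimately have "\<bar>cos (x $ 1) * sin (x $ 2)\<bar> \<le> sqrt 2" "\<bar>sin (x $ 1) * cos (x $ 2)\<bar> \<le> sqrt 2"
        by linarith+
      then show ?thesis
        by (auto simp: sin_sin_riesz_def abs_divide divide_le_eq)
    qed
    then have "\<bar>c * sin_sin_riesz j x\<bar> \<le> \<bar>c\<bar>" for x
      unfolding abs_mult by (intro mult_left_le) auto
    then show "torus_L1_norm (\<lambda>x. c * sin_sin_riesz j x) \<le> ?T"
      by (rule torus_L1_norm_bounded)
  qed (simp add: riesz_transform_sin_sin)
  then have "torus_L1_norm (\<lambda>x. c * sin_sin x)
      + (\<Sum>j\<in>UNIV. INF g\<in>{g. riesz_transform j (\<lambda>x. c * sin_sin x) g}. torus_L1_norm g)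
      \<le> ?T + (\<Sum>j\<in>(UNIV :: 3 set). ?T)"
    by (intro add_mono 1 sum_mono)
  then have "hardy_norm (\<lambda>x. c * sin_sin x) \<le> ?T + (\<Sum>j\<in>(UNIV :: 3 set). ?T)"
    by (simp only: hardy_norm_def torus_L1_sin_sin integral_mult_right_zero integral_sin_sin) simp
  also have "\<dots> = ennreal (4 * measure lebesgue torus_cell * \<bar>c\<bar>)"
    by (subst sum_ennreal) (auto simp: ennreal_plus[symmetric] simp del: ennreal_plus)
  finally show ?thesis .
qed

lemma vec_hardy_norm_sin_sin:
  assumes "\<And>x i. h x $ i = a i * sin_sin x"
  shows "vec_hardy_norm (\<lambda>x. c *\<^sub>R h x)
    \<le> ennreal (4 * measure lebesgue torus_cell * (\<Sum>i\<in>UNIV. \<bar>a i\<bar>) * \<bar>c\<bar>)"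
proof -
  have "hardy_norm (\<lambda>x. (c *\<^sub>R h x) $ i) \<le> ennreal (4 * measure lebesgue torus_cell * \<bar>a i\<bar> * \<bar>c\<bar>)" for i
    using hardy_norm_sin_sin[of "c * a i"] by (simp add: assms abs_mult mult_ac)
  then have "vec_hardy_norm (\<lambda>x. c *\<^sub>R h x)
      \<le> (\<Sum>i\<in>UNIV. ennreal (4 * measure lebesgue torus_cell * \<bar>a i\<bar> * \<bar>c\<bar>))"
    unfolding vec_hardy_norm_def by (rule sum_mono)
  then show ?thesis
    by (simp add: sum_ennreal sum_distrib_left sum_distrib_right)
qed

section \<open>BMO bounds for bounded functions\<close>

lemma mean_osc_le:
  assumes f: "\<And>x. \<bar>f x\<bar> \<le> B" and Q: "Q \<in> lmeasurable"
  shows "mean_osc Q f \<le> 2 * B"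
proof (cases "measure lebesgue Q = 0")
  case True
  \<comment> \<open>Division by 0 yields 0, so a null set has mean oscillation 0; evaluating the
    bound at one point shows that \<open>B\<close> is nonnegative.\<close>
  then show ?thesis
    using f[of 0] by (simp add: mean_osc_def)
next
  case False
  let ?m = "measure lebesgue Q"
  have m: "?m > 0"
    using False measure_nonneg[of lebesgue Q] by linarith
  have const: "integrable (lebesgue_on Q) (\<lambda>_. c)" "(LINT x|lebesgue_on Q. c) = c * ?m" for c :: real
    using Q finite_measure.integrable_const[OF finite_measure_lebesgue_on]
    by (auto simp: measure_restrict_space fmeasurableD)
  have "\<bar>LINT y|lebesgue_on Q. f y\<bar> \<le> (LINT y|lebesgue_on Q. \<bar>f y\<bar>)"
    using integral_norm_bound[of "lebesgue_on Q" f] by simp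
  also have "\<dots> \<le> (LINT y|lebesgue_on Q. B)"
    by (rule integral_mono'[OF const(1)]) (use f order_trans[OF abs_ge_zero f] in auto)
  finally have "\<bar>(LINT y|lebesgue_on Q. f y) / ?m\<bar> \<le> B"
    unfolding const(2) using m by (simp add: divide_le_eq abs_divide)
  then have "\<bar>f x - (LINT y|lebesgue_on Q. f y) / ?m\<bar> \<le> 2 * B" for x
    using f[of x] by linarith
  then have "(LINT x|lebesgue_on Q. \<bar>f x - (LINT y|lebesgue_on Q. f y) / ?m\<bar>) \<le> (LINT x|lebesgue_on Q. 2 * B)"
    by (intro integral_mono'[OF const(1)]) (use order_trans[OF abs_ge_zero f] in auto)
  then show ?thesis
    unfolding mean_osc_def const(2) using m by (simp add: divide_le_eq)
qed

lemma bmo_norm_le: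
  assumes "periodic f" "continuous_on UNIV f" "\<And>x. \<bar>f x\<bar> \<le> B"
  shows "bmo_norm f \<le> ennreal (2 * B)"
  using torus_L1_continuous[OF assms(1,2)]
  by (auto simp: bmo_norm_def intro!: SUP_least ennreal_leI mean_osc_le assms(3))

text \<open>The 6 is three components times the factor 2 in the oscillation bound.\<close>

lemma vec_bmo_norm_scaleR_le:
  assumes "periodic F" "continuous_on UNIV F" "\<And>x i. \<bar>F x $ i\<bar> \<le> 1"
  shows "vec_bmo_norm (\<lambda>x. c *\<^sub>R F x) \<le> ennreal (6 * \<bar>c\<bar>)"
proof -
  have "bmo_norm (\<lambda>x. (c *\<^sub>R F x) $ i) \<le> ennreal (2 * \<bar>c\<bar>)" for i
  proof (rule bmo_norm_le)
    show "\<bar>(c *\<^sub>R F x) $ i\<bar> \<le> \<bar>c\<bar>" for x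
      using assms(3)[of x i] by (simp add: abs_mult mult_left_le)
  qed (use assms in \<open>auto simp: periodic_def intro!: continuous_intros\<close>)
  then have "vec_bmo_norm (\<lambda>x. c *\<^sub>R F x) \<le> (\<Sum>i\<in>(UNIV :: 3 set). ennreal (2 * \<bar>c\<bar>))"
    unfolding vec_bmo_norm_def by (intro sum_mono)
  also have "\<dots> = ennreal (6 * \<bar>c\<bar>)"
    by (subst sum_ennreal) auto
  finally show ?thesis .
qed

section \<open>The Hardy-BMO pairing for bounded fields\<close>

lemma torus_smooth_continuous_on: "torus_smooth f \<Longrightarrow> continuous_on A f"
  by (simp add: torus_smooth_def smooth_continuous_on)

lemma continuous_integrable_torus:
  fixes f :: "real^3 \<Rightarrow> 'b::euclidean_space"
  shows "continuous_on UNIV f \<Longrightarrow> integrable torus_measure f"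
  using continuous_imp_integrable continuous_on_subset by blast

text \<open>For bounded \<open>b\<close> the L^1 summand of the Hardy norm already dominates the
  integral. This is the continuity that identifies the limit in the definition of the
  pairing.\<close>

lemma norm_integral_inner_le_vec_hardy_norm:
  fixes b g :: "real^3 \<Rightarrow> real^3"
  assumes "continuous_on UNIV b" "continuous_on UNIV g" "\<And>x. norm (b x) \<le> B"
  shows "ennreal \<bar>LINT x|torus_measure. b x \<bullet> g x\<bar> \<le> ennreal B * vec_hardy_norm g"
proof -
  have B: "0 \<le> B"
    using assms(3)[of 0] norm_ge_zero order_trans by blast
  have "ennreal \<bar>LINT x|torus_measure. b x \<bullet> g x\<bar> \<le> (\<integral>\<^sup>+x. norm (b x \<bullet> g x) \<partial>torus_measure)"
    using integral_norm_bound_ennreal[of torus_measure "\<lambda>x. b x \<bullet> g x"] assms(1,2)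
    by (simp add: continuous_integrable_torus continuous_on_inner)
  also have "\<dots> \<le> (\<integral>\<^sup>+x. ennreal B * (\<Sum>i\<in>UNIV. ennreal \<bar>g x $ i\<bar>) \<partial>torus_measure)"
  proof (intro nn_integral_mono)
    fix x
    have "norm (b x \<bullet> g x) \<le> norm (b x) * norm (g x)"
      using Cauchy_Schwarz_ineq2[of "b x" "g x"] by simp
    also have "\<dots> \<le> B * (\<Sum>i\<in>UNIV. \<bar>g x $ i\<bar>)"
      by (intro mult_mono assms(3) norm_le_l1_cart B) auto
    finally show "ennreal (norm (b x \<bullet> g x)) \<le> ennreal B * (\<Sum>i\<in>UNIV. ennreal \<bar>g x $ i\<bar>)"
      by (simp add: B ennreal_mult[symmetric] sum_nonneg)
  qed
  also have "\<dots> = ennreal B * (\<Sum>i\<in>UNIV. torus_L1_norm (\<lambda>x. g x $ i))"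
  proof -
    have [measurable]: "(\<lambda>x. g x $ i) \<in> borel_measurable torus_measure" for i
      by (intro borel_measurable_integrable continuous_integrable_torus continuous_intros assms)
    show ?thesis
      unfolding torus_L1_norm_def by (simp add: nn_integral_cmult nn_integral_sum del: sum_ennreal)
  qed
  also have "\<dots> \<le> ennreal B * vec_hardy_norm g"
    unfolding vec_hardy_norm_def by (intro mult_left_mono sum_mono torus_L1_norm_le_hardy_norm) auto
  finally show ?thesis .
qed

text \<open>Every admissible sequence has the integral as its limit by the previous estimate. For
  uniqueness of \<open>c\<close> some admissible sequence must exist: the constant sequence
  \<open>h\<close> serves, and \<open>zero\<close> says that it converges to \<open>h\<close> in the
  Hardy norm.\<close>

lemma bmo_hardy_pairing_eq_integral:
  assumes b: "continuous_on UNIV b" "\<And>x. norm (b x) \<le> B"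
    and h: "torus_smooth h" "vec_hardy_norm h < \<infinity>"
    and zero: "vec_hardy_norm (\<lambda>_. 0) = 0"
  shows "bmo_hardy_pairing b h = (LINT x|torus_measure. b x \<bullet> h x)"
  unfolding bmo_hardy_pairing_def
proof (rule the_equality)
  show "\<forall>hs. (\<forall>n. torus_smooth (hs n) \<and> vec_hardy_norm (hs n) < \<infinity>) \<longrightarrow>
      (\<lambda>n. vec_hardy_norm (\<lambda>x. hs n x - h x)) \<longlonglongrightarrow> 0 \<longrightarrow>
      (\<lambda>n. LINT x|torus_measure. b x \<bullet> hs n x) \<longlonglongrightarrow> (LINT x|torus_measure. b x \<bullet> h x)"
  proof (intro allI impI)
    fix hs :: "nat \<Rightarrow> real^3 \<Rightarrow> real^3"
    assume hs: "\<forall>n. torus_smooth (hs n) \<and> vec_hardy_norm (hs n) < \<infinity>"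
      and lim: "(\<lambda>n. vec_hardy_norm (\<lambda>x. hs n x - h x)) \<longlonglongrightarrow> 0"
    let ?d = "\<lambda>n. (LINT x|torus_measure. b x \<bullet> hs n x) - (LINT x|torus_measure. b x \<bullet> h x)"
    have cont: "continuous_on UNIV (hs n)" "continuous_on UNIV h" for n
      using hs h(1) torus_smooth_continuous_on by auto
    have "?d n = (LINT x|torus_measure. b x \<bullet> (hs n x - h x))" for n
      unfolding inner_diff_right
      by (rule Bochner_Integration.integral_diff[symmetric])
        (intro continuous_integrable_torus continuous_intros cont b)+
    then have "ennreal \<bar>?d n\<bar> \<le> ennreal B * vec_hardy_norm (\<lambda>x. hs n x - h x)" for n
      using norm_integral_inner_le_vec_hardy_norm[OF b(1) _ b(2), of "\<lambda>x. hs n x - h x"] cont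
      by (simp add: continuous_on_diff)
    then have le: "\<forall>\<^sub>F n in sequentially. ennreal \<bar>?d n\<bar> \<le> ennreal B * vec_hardy_norm (\<lambda>x. hs n x - h x)"
      by simp
    have lim0: "(\<lambda>n. ennreal B * vec_hardy_norm (\<lambda>x. hs n x - h x)) \<longlonglongrightarrow> 0"
      using ennreal_tendsto_cmult[OF _ lim, of "ennreal B"] by simp
    have "(\<lambda>n. ennreal \<bar>?d n\<bar>) \<longlonglongrightarrow> ennreal 0"
      unfolding ennreal_0 by (rule tendsto_sandwich[OF _ le tendsto_const lim0]) simp
    then have "(\<lambda>n. \<bar>?d n\<bar>) \<longlonglongrightarrow> 0"
      by (subst (asm) tendsto_ennreal_iff) auto
    then show "(\<lambda>n. LINT x|torus_measure. b x \<bullet> hs n x) \<longlonglongrightarrow> (LINT x|torus_measure. b x \<bullet> h x)"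
      using LIM_zero_cancel tendsto_rabs_zero_iff by blast
  qed
next
  fix c
  assume "\<forall>hs. (\<forall>n. torus_smooth (hs n) \<and> vec_hardy_norm (hs n) < \<infinity>) \<longrightarrow>
      (\<lambda>n. vec_hardy_norm (\<lambda>x. hs n x - h x)) \<longlonglongrightarrow> 0 \<longrightarrow>
      (\<lambda>n. LINT x|torus_measure. b x \<bullet> hs n x) \<longlonglongrightarrow> c"
  from this[rule_format, of "\<lambda>_. h"]
  have "(\<lambda>n :: nat. LINT x|torus_measure. b x \<bullet> h x) \<longlonglongrightarrow> c"
    using h zero by simp
  then show "c = (LINT x|torus_measure. b x \<bullet> h x)"
    by (simp add: LIMSEQ_const_iff)
qed


section \<open>Time profiles\<close>

text \<open>Scalar simple functions approximating \<open>g\<close>, multiplied by the fixed profile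
  \<open>F\<close>, are simple functions with values in the target space. The differences are again
  multiples of \<open>F\<close>, so the linear bound on \<open>N\<close> gives convergence.\<close>

lemma strongly_measurable_scaleR:
  assumes g: "g \<in> borel_measurable (lebesgue_on S)"
    and N: "\<And>c. N (\<lambda>x. c *\<^sub>R F x) \<le> ennreal (K * \<bar>c\<bar>)"
  shows "strongly_measurable N S (\<lambda>t x. g t *\<^sub>R F x)"
proof -
  obtain s where s: "\<And>n. simple_function (lebesgue_on S) (s n)"
    and lim: "\<And>t. t \<in> S \<Longrightarrow> (\<lambda>n. s n t) \<longlonglongrightarrow> g t"
    using borel_measurable_implies_sequence_metric[OF g, of 0] by auto
  show ?thesis
    unfolding strongly_measurable_def
  proof (intro exI[of _ "\<lambda>n t x. s n t *\<^sub>R F x"] conjI allI ballI AE_I2)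
    show "simple_function (lebesgue_on S) (\<lambda>t x. s n t *\<^sub>R F x)" for n
      using s by (rule simple_function_compose1)
    show "N (\<lambda>x. s n t *\<^sub>R F x) < \<infinity>" for n t
      using N by (rule le_less_trans) simp
    show "(\<lambda>n. N (\<lambda>x. g t *\<^sub>R F x - s n t *\<^sub>R F x)) \<longlonglongrightarrow> 0" if "t \<in> space (lebesgue_on S)" for t
    proof (rule tendsto_sandwich[OF _ _ tendsto_const])
      show "\<forall>\<^sub>F n in sequentially. N (\<lambda>x. g t *\<^sub>R F x - s n t *\<^sub>R F x) \<le> ennreal (K * \<bar>g t - s n t\<bar>)"
        using N by (simp add: scaleR_diff_left[symmetric])
      have "(\<lambda>n. K * \<bar>g t - s n t\<bar>) \<longlonglongrightarrow> K * \<bar>g t - g t\<bar>"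
        using that by (intro tendsto_intros lim) simp
      then show "(\<lambda>n. ennreal (K * \<bar>g t - s n t\<bar>)) \<longlonglongrightarrow> 0"
        using tendsto_ennrealI by fastforce
    qed simp
  qed
qed

lemma bochner_norm_scaleR_le:
  assumes p: "p > 0"
    and int: "integrable (lebesgue_on S) (\<lambda>t. \<bar>g t\<bar> ^ p)"
    and K: "0 \<le> K" and N: "\<And>c. N (\<lambda>x. c *\<^sub>R F x) \<le> ennreal (K * \<bar>c\<bar>)"
  shows "bochner_norm p N S (\<lambda>t x. g t *\<^sub>R F x)
    \<le> ennreal (root p (K ^ p * (LINT t|lebesgue_on S. \<bar>g t\<bar> ^ p)))"
proof -
  let ?I = "\<integral>\<^sup>+t. N (\<lambda>x. g t *\<^sub>R F x) ^ p \<partial>lebesgue_on S"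
  let ?J = "K ^ p * (LINT t|lebesgue_on S. \<bar>g t\<bar> ^ p)"
  have "?I \<le> (\<integral>\<^sup>+t. ennreal (K ^ p * \<bar>g t\<bar> ^ p) \<partial>lebesgue_on S)"
  proof (rule nn_integral_mono)
    fix t
    have "N (\<lambda>x. g t *\<^sub>R F x) ^ p \<le> ennreal (K * \<bar>g t\<bar>) ^ p"
      using N by (rule power_mono) simp
    then show "N (\<lambda>x. g t *\<^sub>R F x) ^ p \<le> ennreal (K ^ p * \<bar>g t\<bar> ^ p)"
      using K by (simp add: ennreal_power power_mult_distrib)
  qed
  also have "\<dots> = ennreal ?J"
    using int K by (subst nn_integral_eq_integral) auto
  finally have le: "?I \<le> ennreal ?J" .
  then have "?I \<noteq> \<infinity>"
    using order_le_less_trans[of ?I "ennreal ?J" \<infinity>] by auto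
  moreover have "enn2real ?I \<le> ?J"
    using le K by (intro enn2real_leI) auto
  ultimately show ?thesis
    using p by (simp add: bochner_norm_def Let_def ennreal_leI)
qed

lemma in_bochner_scaleR:
  assumes "p > 0" "g \<in> borel_measurable (lebesgue_on S)"
    "integrable (lebesgue_on S) (\<lambda>t. \<bar>g t\<bar> ^ p)"
    "0 \<le> K" "\<And>c. N (\<lambda>x. c *\<^sub>R F x) \<le> ennreal (K * \<bar>c\<bar>)"
  shows "in_bochner p N S (\<lambda>t x. g t *\<^sub>R F x)"
  unfolding in_bochner_def
proof
  show "strongly_measurable N S (\<lambda>t x. g t *\<^sub>R F x)"
    by (rule strongly_measurable_scaleR) (rule assms)+
  have "bochner_norm p N S (\<lambda>t x. g t *\<^sub>R F x)
      \<le> ennreal (root p (K ^ p * (LINT t|lebesgue_on S. \<bar>g t\<bar> ^ p)))"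
    by (rule bochner_norm_scaleR_le) (rule assms)+
  then show "bochner_norm p N S (\<lambda>t x. g t *\<^sub>R F x) < \<infinity>"
    by (rule le_less_trans) simp
qed

text \<open>The exponent is chosen to make the weight integrable but not square integrable near 1.\<close>

definition time_weight :: "real \<Rightarrow> real" where
  "time_weight t = (1 - t) powr (- 3 / 4)"

lemma
  assumes "a < 1"
  shows integrable_time_weight: "integrable (lebesgue_on {a<..<1}) time_weight"
    and integral_time_weight: "(LINT t|lebesgue_on {a<..<1}. time_weight t) = 4 * (1 - a) powr (1 / 4)"
proof -
  have "((\<lambda>x. x powr (- 3 / 4)) has_integral (4 * (1 - a) powr (1 / 4))) (cbox 0 (1 - a))"
    using has_integral_powr_from_0[of "- 3 / 4" "1 - a"] assms by (simp add: mult.commute)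
  \<comment> \<open>The reflection t -> 1 - t moves the singularity from 0 to the right
    endpoint.\<close>
  from has_integral_affinity[OF this, of "-1" 1]
  have "(time_weight has_integral (4 * (1 - a) powr (1 / 4))) ((\<lambda>x. 1 - x) ` {0..1 - a})"
    by (simp add: time_weight_def[abs_def])
  also have "(\<lambda>x. 1 - x) ` {0..1 - a} = cbox a 1"
    by simp
  finally have hi: "(time_weight has_integral (4 * (1 - a) powr (1 / 4))) {a<..<1}"
    using has_integral_open_interval[of time_weight _ a 1] by simp
  then have "time_weight absolutely_integrable_on {a<..<1}"
    by (intro nonnegative_absolutely_integrable_1) (auto simp: time_weight_def integrable_on_def)
  then show int: "integrable (lebesgue_on {a<..<1}) time_weight"
    by (simp add: integrable_restrict_space set_integrable_def)
  show "(LINT t|lebesgue_on {a<..<1}. time_weight t) = 4 * (1 - a) powr (1 / 4)"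
    using lebesgue_integral_eq_integral[OF int] hi by (simp add: integral_unique)
qed

section \<open>Test functions concentrating at the final time\<close>

lemma integrable_bump: "integrable lborel bump"
proof -
  have "indicator {0..1} s *\<^sub>R bump s = bump s" for s
    using bump_eq_0[of s] by (cases "s \<in> {0..1}") auto
  moreover have "integrable lborel (\<lambda>s. indicator {0..1} s *\<^sub>R bump s)"
    by (rule borel_integrable_compact) (auto intro: smooth_continuous_on smooth_bump)
  ultimately show ?thesis
    by (simp only:)
qed

lemma integral_bump_pos: "0 < (LINT s|lborel. bump s)"
proof (rule ccontr)
  assume "\<not> ?thesis"
  then have "(LINT s|lborel. bump s) = 0"
    using Bochner_Integration.integral_nonneg[of lborel bump] bump_nonneg by fastforce
  then have "AE s in lborel. bump s = 0"
    by (subst (asm) integral_nonneg_eq_0_iff_AE) (auto simp: integrable_bump bump_nonneg)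
  then have "AE s in lborel. s \<notin> {0<..<1 :: real}"
    by eventually_elim (use bump_pos in force)
  then have "emeasure lborel {0<..<1 :: real} = 0"
    by (subst (asm) AE_iff_measurable[of "{0<..<1}"]) auto
  then show False
    by simp
qed

lemma integrable_bounded_continuous:
  fixes g :: "real \<Rightarrow> real"
  assumes "continuous_on UNIV g" "\<And>t. \<bar>g t\<bar> \<le> B"
  shows "integrable (lebesgue_on {a<..<b}) g"
proof (rule finite_measure.integrable_const_bound[OF finite_measure_lebesgue_on])
  show "g \<in> borel_measurable (lebesgue_on {a<..<b})"
    using continuous_on_subset[OF assms(1)] by (intro continuous_imp_measurable_on_sets_lebesgue) auto
qed (use assms(2) in auto)

lemma concentrated_test_function:
  assumes "\<tau> < 1" "0 < q"
  obtains b :: "real \<Rightarrow> real" where "smooth b" "closure {t. b t \<noteq> 0} \<subseteq> {\<tau><..<1}"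
    "integrable (lebesgue_on {\<tau><..<1}) (\<lambda>t. (b t)\<^sup>2)"
    "(LINT t|lebesgue_on {\<tau><..<1}. (b t)\<^sup>2) \<le> 1"
    "(LINT t|lebesgue_on {\<tau><..<1}. time_weight t * b t) = q"
proof -
  define I where "I = (LINT s|lborel. bump s)"
  have I: "0 < I"
    unfolding I_def by (rule integral_bump_pos)
  \<comment> \<open>A bump of width r/2 at distance r from 1, normalised to pair to q with the weight, has \<open>L\<^sup>2\<close> norm
    of order \<open>r\<^sup>1\<^sup>/\<^sup>4\<close>.\<close>
  define r where "r = min ((1 - \<tau>) / 2) ((I / (2 * q\<^sup>2))\<^sup>2)"
  have r: "0 < r" "r < 1 - \<tau>"
    using assms I by (auto simp: r_def min_less_iff_disj)
  \<comment> \<open>With \<open>e\<^sup>2 * (r * sqrt r) = 1\<close> as proved below, the decisive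
    inequality \<open>q\<^sup>2 * (r / 2 * I) \<le> (e * (r / 2 * I))\<^sup>2\<close> amounts to
    \<open>2 * q\<^sup>2 * sqrt r \<le> I\<close>. This dictates the second argument of
    \<open>min\<close>.\<close>
  have "sqrt r \<le> sqrt ((I / (2 * q\<^sup>2))\<^sup>2)"
    unfolding real_sqrt_le_iff r_def by simp
  then have sqrt_r: "2 * q\<^sup>2 * sqrt r \<le> I"
    using assms I by (simp add: real_sqrt_power[symmetric] le_divide_eq mult.commute)
  let ?M = "lebesgue_on {\<tau><..<1}"
  \<comment> \<open>The affine map sends \<open>1 - r\<close> to 0 and \<open>1 - r / 2\<close> to
    1, so the support keeps a positive distance from both \<tau> and 1.\<close>
  define \<beta> where "\<beta> t = bump (2 / r * t + (- 2 * (1 - r) / r))" for t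
  have smooth: "smooth \<beta>"
    unfolding \<beta>_def[abs_def] by (rule smooth_compose_affine[of bump, OF smooth_bump])
  have cont: "continuous_on UNIV \<beta>"
    using smooth by (rule smooth_continuous_on)
  have \<beta>01: "0 \<le> \<beta> t" "\<beta> t \<le> 1" for t
    by (simp_all add: \<beta>_def bump_nonneg bump_le_1)
  have supp: "t \<in> {1 - r..1 - r / 2}" if "\<beta> t \<noteq> 0" for t
  proof -
    have "2 / r * t + (- 2 * (1 - r) / r) \<in> {0<..<1}"
      using that bump_eq_0[of "2 / r * t + (- 2 * (1 - r) / r)"] by (auto simp only: \<beta>_def)
    then show ?thesis
      using r by (auto simp: field_simps)
  qed
  have int_\<beta>: "integrable ?M \<beta>"
    using \<beta>01 by (intro integrable_bounded_continuous[OF cont, of 1]) simp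
  have int_\<beta>2: "integrable ?M (\<lambda>t. (\<beta> t)\<^sup>2)"
    using \<beta>01 by (intro integrable_bounded_continuous[of _ 1] continuous_intros cont) (simp add: power_le_one)
  have "(LINT t|?M. \<beta> t) = (LINT t|lebesgue. indicator {\<tau><..<1} t *\<^sub>R \<beta> t)"
    by (rule integral_restrict_space) simp
  also have "\<dots> = (LINT t|lebesgue. \<beta> t)"
  proof (rule Bochner_Integration.integral_cong[OF refl])
    show "indicator {\<tau><..<1} t *\<^sub>R \<beta> t = \<beta> t" for t
      using supp[of t] r by (cases "\<beta> t = 0") auto
  qed
  also have "\<dots> = (LINT t|lborel. \<beta> t)"
    by (rule integral_completion) (simp add: borel_measurable_continuous_onI cont)
  also have "\<dots> = r / 2 * I"
    using r unfolding I_def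
    by (subst lborel_integral_real_affine[of "r / 2" _ "1 - r"])
      (auto simp: \<beta>_def diff_divide_distrib distrib_left)
  finally have \<beta>_integral: "(LINT t|?M. \<beta> t) = r / 2 * I" .
  \<comment> \<open>\<open>e\<close> is the weight at \<open>1 - r\<close>, hence its least value on
    the support of \<open>\<beta>\<close>, because the weight increases towards 1.\<close>
  define e where "e = r powr (- 3 / 4)"
  have e: "0 < e"
    using r by (simp add: e_def)
  have "e\<^sup>2 * (r * sqrt r) = r powr (- 3 / 4) * r powr (- 3 / 4) * (r powr 1 * r powr (1 / 2))"
    using r by (simp add: e_def power2_eq_square powr_half_sqrt)
  also have "\<dots> = 1"
    using r by (simp only: powr_add[symmetric]) simp
  finally have e2: "e\<^sup>2 * (r * sqrt r) = 1" .
  have int_w: "integrable ?M (\<lambda>t. time_weight t * \<beta> t)"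
  proof (rule Bochner_Integration.integrable_bound[OF integrable_time_weight[OF assms(1)]])
    show "(\<lambda>t. time_weight t * \<beta> t) \<in> borel_measurable ?M"
      using borel_measurable_integrable[OF integrable_time_weight[OF assms(1)]]
        borel_measurable_integrable[OF int_\<beta>] by measurable
    show "AE t in ?M. norm (time_weight t * \<beta> t) \<le> norm (time_weight t)"
      using \<beta>01 by (intro AE_I2) (simp add: abs_mult mult_left_le)
  qed
  define m where "m = (LINT t|?M. time_weight t * \<beta> t)"
  have "e * (r / 2 * I) = (LINT t|?M. e * \<beta> t)"
    by (simp add: \<beta>_integral)
  also have "\<dots> \<le> m"
    unfolding m_def
  proof (rule integral_mono)
    fix t
    show "e * \<beta> t \<le> time_weight t * \<beta> t"
    proof (cases "\<beta> t = 0")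
      case False
      then have "e \<le> time_weight t"
        using supp[OF False] r unfolding e_def time_weight_def by (intro powr_mono2') auto
      then show ?thesis
        using \<beta>01(1) by (rule mult_right_mono)
    qed simp
  qed (use int_\<beta> int_w in auto)
  finally have m_ge: "e * (r / 2 * I) \<le> m" .
  have m: "0 < m"
    by (rule less_le_trans[OF _ m_ge]) (use e r I in simp)
  have "q\<^sup>2 = e\<^sup>2 * r * (q\<^sup>2 * sqrt r)"
    using arg_cong[OF e2, of "\<lambda>z. z * q\<^sup>2"] by (simp only: mult_ac mult_1_right)
  also have "\<dots> \<le> e\<^sup>2 * r * (I / 2)"
    using sqrt_r r by (intro mult_left_mono) auto
  finally have "q\<^sup>2 * (r / 2 * I) \<le> e\<^sup>2 * r * (I / 2) * (r / 2 * I)"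
    using r I by (intro mult_right_mono) auto
  also have "\<dots> = (e * (r / 2 * I))\<^sup>2"
    by (simp add: power2_eq_square)
  also have "\<dots> \<le> m\<^sup>2"
    using m_ge e r I by (intro power_mono) auto
  finally have q_le: "q\<^sup>2 * (r / 2 * I) \<le> m\<^sup>2" .
  show ?thesis
  \<comment> \<open>The factor \<open>q / m\<close> makes the pairing equal to \<open>q\<close>.
    Since \<open>\<beta>\<close> lies between 0 and 1, its square integrates to at most
    \<open>r / 2 * I\<close>, and \<open>q_le\<close> is exactly the remaining bound on the L^2
    norm.\<close>
  proof (rule that[of "\<lambda>t. q / m * \<beta> t"])
    show "smooth (\<lambda>t. q / m * \<beta> t)"
      by (intro smooth_mult smooth_const smooth)
    have "closure {t. q / m * \<beta> t \<noteq> 0} \<subseteq> {1 - r..1 - r / 2}"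
      using supp by (intro closure_minimal) auto
    then show "closure {t. q / m * \<beta> t \<noteq> 0} \<subseteq> {\<tau><..<1}"
      using r by force
    show "integrable ?M (\<lambda>t. (q / m * \<beta> t)\<^sup>2)"
      unfolding power_mult_distrib using int_\<beta>2 by simp
    have "(LINT t|?M. (\<beta> t)\<^sup>2) \<le> r / 2 * I"
      unfolding \<beta>_integral[symmetric]
      using \<beta>01 by (intro integral_mono int_\<beta> int_\<beta>2) (simp add: power2_eq_square mult_left_le)
    then have "q\<^sup>2 * (LINT t|?M. (\<beta> t)\<^sup>2) \<le> m\<^sup>2"
      by (intro order_trans[OF _ q_le] mult_left_mono) auto
    then show "(LINT t|?M. (q / m * \<beta> t)\<^sup>2) \<le> 1"
      using m by (simp add: power_mult_distrib power_divide divide_le_eq)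
    have "(LINT t|?M. time_weight t * (q / m * \<beta> t)) = q / m * m"
      unfolding m_def by (subst integral_mult_right_zero[symmetric]) (simp add: mult_ac)
    then show "(LINT t|?M. time_weight t * (q / m * \<beta> t)) = q"
      using m by simp
  qed
qed


section \<open>The fields\<close>

lemma has_derivative_vec_nth: "((\<lambda>x. x $ j) has_derivative (\<lambda>v. v $ j)) F"
  by (rule bounded_linear_imp_has_derivative[OF bounded_linear_vec_nth])

text \<open>\<open>(shear \<sqdot> \<nabla>) compression\<close> is \<^const>\<open>sin_sin\<close> in the first component, which is also the first
  component of \<open>cellular\<close>. The potential of \<open>compression\<close> is \<open>- sin x\<^sub>1\<close>.\<close>

definition cellular :: "3 \<Rightarrow> real^3 \<Rightarrow> real" where
  "cellular i = (if i = 1 then sin_sin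
     else if i = 2 then (\<lambda>x. cos (x $ 1) * cos (x $ 2)) else (\<lambda>_. 0))"

definition shear :: "3 \<Rightarrow> real^3 \<Rightarrow> real" where
  "shear i = (if i = 1 then (\<lambda>x. sin (x $ 2)) else (\<lambda>_. 0))"

definition compression :: "3 \<Rightarrow> real^3 \<Rightarrow> real" where
  "compression i = (if i = 1 then (\<lambda>x. - 1 * cos (x $ 1)) else (\<lambda>_. 0))"

lemma smooth_sin_sin: "smooth sin_sin"
  unfolding sin_sin_def[abs_def] by (intro smooth_mult smooth_sin_nth)

lemma smooth_cellular: "smooth (cellular i)"
  by (auto simp: cellular_def intro!: smooth_sin_sin smooth_mult smooth_cos_nth smooth_const)

lemma smooth_shear: "smooth (shear i)"
  by (auto simp: shear_def intro!: smooth_sin_nth smooth_const)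

lemma smooth_compression: "smooth (compression i)"
  unfolding compression_def
  by (cases "i = 1") (simp_all only: if_True if_False simp_thms smooth_const smooth_mult smooth_cos_nth)

lemma torus_smooth_vec_lambda:
  fixes f :: "'n::finite \<Rightarrow> real^3 \<Rightarrow> real"
  assumes "\<And>i. smooth (f i)" "\<And>i. periodic (f i)"
  shows "torus_smooth (\<lambda>x. \<chi> i. f i x)"
  using assms smooth_vec_lambda[of f] unfolding torus_smooth_def by (simp add: periodic_def)

lemma torus_smooth_cellular: "torus_smooth (\<lambda>x. \<chi> i. cellular i x)"
  by (rule torus_smooth_vec_lambda[OF smooth_cellular])
    (auto simp: periodic_def cellular_def sin_sin_def axis_def)

lemma torus_smooth_shear: "torus_smooth (\<lambda>x. \<chi> i. shear i x)"
  by (rule torus_smooth_vec_lambda[OF smooth_shear]) (auto simp: periodic_def shear_def axis_def)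

lemma torus_smooth_compression: "torus_smooth (\<lambda>x. \<chi> i. compression i x)"
  by (rule torus_smooth_vec_lambda[OF smooth_compression])
    (auto simp: periodic_def compression_def axis_def)

text \<open>The field is (-d_2 psi, d_1 psi, 0) for the stream function psi = sin x_1 cos x_2, so
  the mixed derivatives cancel.\<close>

lemma divergence_free_cellular: "divergence_free (\<lambda>x. \<chi> i. cellular i x)"
proof -
  have "dir_deriv v (cellular 1) x = v $ 1 * cos (x $ 1) * sin (x $ 2) + sin (x $ 1) * (v $ 2 * cos (x $ 2))" for v x
    unfolding cellular_def sin_sin_def[abs_def]
    by (rule dir_deriv_eqI) (auto intro!: derivative_eq_intros has_derivative_vec_nth)
  moreover have "dir_deriv v (cellular 2) x = - (v $ 1 * sin (x $ 1) * cos (x $ 2)) - cos (x $ 1) * (v $ 2 * sin (x $ 2))" for v x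
    unfolding cellular_def
    by (rule dir_deriv_eqI) (auto intro!: derivative_eq_intros has_derivative_vec_nth)
  moreover have "dir_deriv v (cellular 3) x = 0" for v x
    by (simp add: cellular_def dir_deriv_const)
  ultimately show ?thesis
    unfolding divergence_free_def divergence_def
    by (simp add: dir_deriv_vec_lambda[OF smooth_cellular] sum_3 axis_def)
qed

lemma divergence_free_shear: "divergence_free (\<lambda>x. \<chi> i. shear i x)"
proof -
  have "dir_deriv v (shear 1) x = v $ 2 * cos (x $ 2)" for v x
    unfolding shear_def
    by (rule dir_deriv_eqI) (auto intro!: derivative_eq_intros has_derivative_vec_nth)
  moreover have "dir_deriv v (shear 2) x = 0" "dir_deriv v (shear 3) x = 0" for v x
    by (simp_all add: shear_def dir_deriv_const)
  ultimately show ?thesis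
    unfolding divergence_free_def divergence_def
    by (simp add: dir_deriv_vec_lambda[OF smooth_shear] sum_3 axis_def)
qed

lemma gradient_field_compression: "gradient_field (\<lambda>x. \<chi> i. compression i x)"
  unfolding gradient_field_def
proof (intro exI conjI allI)
  show "torus_smooth (\<lambda>x :: real^3. - 1 * sin (x $ 1))"
    unfolding torus_smooth_def
    by (intro conjI smooth_mult smooth_const smooth_sin_nth) (auto simp: periodic_def axis_def)
  show "GDERIV (\<lambda>x. - 1 * sin (x $ 1)) x :> (\<chi> i. compression i x)" for x
    unfolding gderiv_def
    by (auto intro!: derivative_eq_intros has_derivative_vec_nth
        simp: inner_vec_def sum_3 compression_def)
qed

lemma advect_shear_compression:
  "advect (\<lambda>x. \<chi> i. shear i x) (\<lambda>x. \<chi> i. compression i x) x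
    = (\<chi> i. if i = 1 then sin_sin x else 0)"
proof -
  have "dir_deriv v (compression 1) x = v $ 1 * sin (x $ 1)" for v
    unfolding compression_def
    by (rule dir_deriv_eqI) (auto intro!: derivative_eq_intros has_derivative_vec_nth)
  moreover have "dir_deriv v (compression i) x = 0" if "i \<noteq> 1" for v i
    using that by (simp add: compression_def dir_deriv_const)
  ultimately show ?thesis
    by (auto simp: advect_def vec_eq_iff sum_3 dir_deriv_vec_lambda[OF smooth_compression]
        shear_def axis_def sin_sin_def)
qed

theorem proposition10p1:
  shows "\<exists>(V :: real^3 \<Rightarrow> real^3) (Y :: real^3 \<Rightarrow> real^3) (G :: real^3 \<Rightarrow> real^3)
           (\<eta> :: real \<Rightarrow> real) (b :: real \<Rightarrow> real \<Rightarrow> real).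
    torus_smooth V \<and> divergence_free V \<and>
    torus_smooth Y \<and> divergence_free Y \<and>
    torus_smooth G \<and> gradient_field G \<and>
    integrable (lebesgue_on {0<..<1}) \<eta> \<and>
    (\<forall>\<tau>\<in>{0<..<1}.
       smooth (b \<tau>) \<and> closure {t. b \<tau> t \<noteq> 0} \<subseteq> {\<tau><..<1} \<and>
       sqrt (LINT t|lebesgue_on {\<tau><..<1}. (b \<tau> t)\<^sup>2) \<le> 1 \<and>
       (LINT t|lebesgue_on {\<tau><..<1}. \<eta> t * b \<tau> t) *
         (LINT x|torus_measure. V x \<bullet> advect Y G x) = 1) \<and>
    (let u = (\<lambda>t x. \<eta> t *\<^sub>R V x);
         k = (\<lambda>\<tau> t x. b \<tau> t *\<^sub>R advect Y G x)
     in (\<forall>\<tau>\<in>{0<..<1}. in_bochner 1 vec_bmo_norm {\<tau><..<1} u) \<and>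
        ((\<lambda>\<tau>. bochner_norm 1 vec_bmo_norm {\<tau><..<1} u) \<longlongrightarrow> 0) (at_left 1) \<and>
        (\<exists>C :: real. \<forall>\<tau>\<in>{0<..<1}.
           in_bochner 2 vec_hardy_norm {\<tau><..<1} (k \<tau>) \<and>
           bochner_norm 2 vec_hardy_norm {\<tau><..<1} (k \<tau>) \<le> ennreal C) \<and>
        (\<forall>\<tau>\<in>{0<..<1}.
           (LINT t|lebesgue_on {\<tau><..<1}. bmo_hardy_pairing (u t) (k \<tau> t)) = 1))"
proof -
  define V :: "real^3 \<Rightarrow> real^3" where "V = (\<lambda>x. \<chi> i. cellular i x)"
  define Y :: "real^3 \<Rightarrow> real^3" where "Y = (\<lambda>x. \<chi> i. shear i x)"
  define G :: "real^3 \<Rightarrow> real^3" where "G = (\<lambda>x. \<chi> i. compression i x)"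
  define A where "A = advect Y G"
  define M where "M = (LINT x|torus_measure. V x \<bullet> A x)"
  define K where "K = 4 * measure lebesgue torus_cell"
  have A: "A x = (\<chi> i. if i = 1 then sin_sin x else 0)" for x
    unfolding A_def Y_def G_def by (rule advect_shear_compression)
  have "V x \<bullet> A x = sin_sin x * sin_sin x" for x
    by (simp add: V_def A inner_vec_def sum_3 cellular_def)
  then have "M = 2 * pi ^ 3"
    by (simp add: M_def integral_sin_sin_squared)
  then have M: "0 < M"
    by simp
  \<comment> \<open>Bundling the properties for one \<tau> lets a single use of choice produce the
    whole family \<open>b\<close>. The value \<open>1 / M\<close> is the reciprocal of the space
    integral, so the product of the two integrals is 1.\<close>
  define test :: "real \<Rightarrow> (real \<Rightarrow> real) \<Rightarrow> bool" where
    "test \<tau> b \<longleftrightarrow> smooth b \<and> closure {t. b t \<noteq> 0} \<subseteq> {\<tau><..<1} \<and>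
      integrable (lebesgue_on {\<tau><..<1}) (\<lambda>t. (b t)\<^sup>2) \<and>
      (LINT t|lebesgue_on {\<tau><..<1}. (b t)\<^sup>2) \<le> 1 \<and>
      (LINT t|lebesgue_on {\<tau><..<1}. time_weight t * b t) = 1 / M" for \<tau> b
  have "\<exists>b. test \<tau> b" if "\<tau> \<in> {0<..<1}" for \<tau>
  proof (rule concentrated_test_function[of \<tau> "1 / M"])
    show "\<tau> < 1" "0 < 1 / M"
      using that M by auto
  qed (auto simp: test_def)
  then obtain b where "\<forall>\<tau>\<in>{0<..<1}. test \<tau> (b \<tau>)"
    by (metis bchoice)
  then have b:
    "smooth (b \<tau>)" "closure {t. b \<tau> t \<noteq> 0} \<subseteq> {\<tau><..<1}"
    "integrable (lebesgue_on {\<tau><..<1}) (\<lambda>t. (b \<tau> t)\<^sup>2)"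
    "(LINT t|lebesgue_on {\<tau><..<1}. (b \<tau> t)\<^sup>2) \<le> 1"
    "(LINT t|lebesgue_on {\<tau><..<1}. time_weight t * b \<tau> t) = 1 / M"
    if "\<tau> \<in> {0<..<1}" for \<tau>
    using that unfolding test_def by blast+
  have contV: "continuous_on UNIV V" and perV: "periodic V"
    using torus_smooth_cellular by (auto simp: V_def torus_smooth_continuous_on torus_smooth_def)
  have V_le: "\<bar>V x $ i\<bar> \<le> 1" for x i
    by (auto simp: V_def cellular_def sin_sin_def abs_mult intro!: mult_le_one)
  have bmo: "vec_bmo_norm (\<lambda>x. c *\<^sub>R V x) \<le> ennreal (6 * \<bar>c\<bar>)" for c
    by (rule vec_bmo_norm_scaleR_le[OF perV contV V_le])
  have K: "0 \<le> K"
    by (simp add: K_def)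
  have hardy: "vec_hardy_norm (\<lambda>x. c *\<^sub>R A x) \<le> ennreal (K * \<bar>c\<bar>)" for c
  proof -
    have "A x $ i = (if i = 1 then 1 else 0) * sin_sin x" for x i
      by (simp add: A)
    from vec_hardy_norm_sin_sin[OF this, of c] show ?thesis
      by (simp add: K_def sum_3)
  qed
  have int_w: "integrable (lebesgue_on {\<tau><..<1}) (\<lambda>t. \<bar>time_weight t\<bar> ^ 1)" if "\<tau> < 1" for \<tau>
    using integrable_time_weight[OF that] by simp
  have u_in: "in_bochner 1 vec_bmo_norm {\<tau><..<1} (\<lambda>t x. time_weight t *\<^sub>R V x)" if "\<tau> < 1" for \<tau>
    by (rule in_bochner_scaleR[where N = vec_bmo_norm and K = 6, OF _ _ int_w[OF that] _ bmo])
      (use borel_measurable_integrable[OF integrable_time_weight[OF that]] in auto)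
  \<comment> \<open>The 24 is the BMO constant 6 times the factor 4 from integrating the weight; the
    positive power 1/4 left over makes the tails vanish.\<close>
  have u_le: "bochner_norm 1 vec_bmo_norm {\<tau><..<1} (\<lambda>t x. time_weight t *\<^sub>R V x)
      \<le> ennreal (24 * (1 - \<tau>) powr (1 / 4))" if "\<tau> < 1" for \<tau>
  proof -
    have "(LINT t|lebesgue_on {\<tau><..<1}. \<bar>time_weight t\<bar> ^ 1) = 4 * (1 - \<tau>) powr (1 / 4)"
      using integral_time_weight[OF that] by (simp add: time_weight_def)
    then show ?thesis
      using bochner_norm_scaleR_le[where N = vec_bmo_norm and K = 6, OF _ int_w[OF that] _ bmo] by simp
  qed
  have "((\<lambda>\<tau>. 24 * (1 - \<tau>) powr (1 / 4)) \<longlongrightarrow> 24 * (1 - 1) powr (1 / 4)) (at_left (1 :: real))"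
    by (intro tendsto_intros) (auto simp: eventually_at_filter)
  then have lim: "((\<lambda>\<tau>. ennreal (24 * (1 - \<tau>) powr (1 / 4))) \<longlongrightarrow> 0) (at_left 1)"
    using tendsto_ennrealI by fastforce
  have u_lim: "((\<lambda>\<tau>. bochner_norm 1 vec_bmo_norm {\<tau><..<1} (\<lambda>t x. time_weight t *\<^sub>R V x)) \<longlongrightarrow> 0) (at_left 1)"
  proof (rule tendsto_sandwich[OF _ _ tendsto_const lim])
    show "\<forall>\<^sub>F \<tau> in at_left 1. bochner_norm 1 vec_bmo_norm {\<tau><..<1} (\<lambda>t x. time_weight t *\<^sub>R V x)
        \<le> ennreal (24 * (1 - \<tau>) powr (1 / 4))"
      unfolding eventually_at_filter by (intro always_eventually allI impI u_le) simp
  qed simp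
  have k: "in_bochner 2 vec_hardy_norm {\<tau><..<1} (\<lambda>t x. b \<tau> t *\<^sub>R A x)"
    "bochner_norm 2 vec_hardy_norm {\<tau><..<1} (\<lambda>t x. b \<tau> t *\<^sub>R A x) \<le> ennreal K"
    if \<tau>: "\<tau> \<in> {0<..<1}" for \<tau>
  proof -
    have int: "integrable (lebesgue_on {\<tau><..<1}) (\<lambda>t. \<bar>b \<tau> t\<bar> ^ 2)"
      using b(3)[OF \<tau>] by simp
    have "b \<tau> \<in> borel_measurable (lebesgue_on {\<tau><..<1})"
      using smooth_continuous_on[OF b(1)[OF \<tau>]]
      by (intro continuous_imp_measurable_on_sets_lebesgue) auto
    then show "in_bochner 2 vec_hardy_norm {\<tau><..<1} (\<lambda>t x. b \<tau> t *\<^sub>R A x)"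
      by (intro in_bochner_scaleR[where N = vec_hardy_norm, OF _ _ int K hardy]) auto
    have "bochner_norm 2 vec_hardy_norm {\<tau><..<1} (\<lambda>t x. b \<tau> t *\<^sub>R A x)
        \<le> ennreal (root 2 (K\<^sup>2 * (LINT t|lebesgue_on {\<tau><..<1}. \<bar>b \<tau> t\<bar>\<^sup>2)))"
      by (rule bochner_norm_scaleR_le[where N = vec_hardy_norm, OF _ int K hardy]) simp
    also have "\<dots> \<le> ennreal (root 2 (K\<^sup>2 * 1))"
      using b(4)[OF \<tau>] by (intro ennreal_leI real_root_le_mono mult_left_mono) auto
    also have "\<dots> = ennreal K"
      using K by (simp add: sqrt_def[symmetric])
    finally show "bochner_norm 2 vec_hardy_norm {\<tau><..<1} (\<lambda>t x. b \<tau> t *\<^sub>R A x) \<le> ennreal K" .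
  qed
  \<comment> \<open>The time is fixed here, with \<open>c\<close> and \<open>d\<close> the values of
    the weight and of \<open>b\<close> \<tau>. The sup bound \<open>\<bar>c\<bar> * 3\<close> may
    therefore depend on time, and the singularity of the weight at 1 does no harm.\<close>
  have pairing: "bmo_hardy_pairing (\<lambda>x. c *\<^sub>R V x) (\<lambda>x. d *\<^sub>R A x) = M * (c * d)" for c d
  proof -
    have "(\<lambda>x. d *\<^sub>R A x) = (\<lambda>x. \<chi> i. (if i = 1 then d else 0) * sin_sin x)"
      by (auto simp: A vec_eq_iff)
    moreover have "torus_smooth (\<lambda>x. \<chi> i :: 3. (if i = 1 then d else 0) * sin_sin x)"
      by (intro torus_smooth_vec_lambda smooth_mult smooth_const smooth_sin_sin)
        (auto simp: periodic_def sin_sin_def axis_def)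
    ultimately have smooth: "torus_smooth (\<lambda>x. d *\<^sub>R A x)"
      by simp
    have "norm (V x) \<le> 3" for x
      using norm_le_l1_cart[of "V x"] V_le[of x 1] V_le[of x 2] V_le[of x 3] by (simp add: sum_3)
    then have bound: "norm (c *\<^sub>R V x) \<le> \<bar>c\<bar> * 3" for x
      by (simp add: mult_left_mono)
    have "vec_hardy_norm (\<lambda>x. d *\<^sub>R A x) < \<infinity>"
      using hardy by (rule le_less_trans) simp
    \<comment> \<open>The linear bound at the scalar 0 gives the norm of the zero field without a
      separate look at its Riesz transforms.\<close>
    moreover have "vec_hardy_norm (\<lambda>_. 0) = 0"
      using hardy[of 0] by simp
    ultimately have "bmo_hardy_pairing (\<lambda>x. c *\<^sub>R V x) (\<lambda>x. d *\<^sub>R A x)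
        = (LINT x|torus_measure. (c *\<^sub>R V x) \<bullet> (d *\<^sub>R A x))"
      by (intro bmo_hardy_pairing_eq_integral[OF _ bound smooth] continuous_intros contV)
    also have "\<dots> = M * (c * d)"
      by (simp add: M_def)
    finally show ?thesis .
  qed
  have pair: "(LINT t|lebesgue_on {\<tau><..<1}.
      bmo_hardy_pairing (\<lambda>x. time_weight t *\<^sub>R V x) (\<lambda>x. b \<tau> t *\<^sub>R A x)) = 1" if "\<tau> \<in> {0<..<1}" for \<tau>
    unfolding pairing integral_mult_right_zero b(5)[OF that] using M by simp
  show ?thesis
    unfolding Let_def
  proof (rule exI[of _ V], rule exI[of _ Y], rule exI[of _ G], rule exI[of _ time_weight],
      rule exI[of _ b], intro exI[of _ K] conjI ballI)
    show "(LINT t|lebesgue_on {\<tau><..<1}. time_weight t * b \<tau> t)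
        * (LINT x|torus_measure. V x \<bullet> advect Y G x) = 1" if "\<tau> \<in> {0<..<1}" for \<tau>
      unfolding b(5)[OF that] A_def[symmetric] M_def[symmetric] using M by simp
  qed (use b u_in u_lim k pair integrable_time_weight[of 0] in
      \<open>auto simp: V_def Y_def G_def A_def torus_smooth_cellular torus_smooth_shear
        torus_smooth_compression divergence_free_cellular divergence_free_shear
        gradient_field_compression\<close>)
qed

end
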